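(* Let $A\in\mathbb{R}^{n\times n}$, $B\in\mathbb{R}^{n\times m}$, $C\in\mathbb{R}^{p\times n}$, let $S\in\mathbb{R}^{r\times r}$ be a full-rank matrix, and let $L_1\in\mathbb{R}^{m\times r}$, $L_2\in\mathbb{R}^{m\times r^2}$. Suppose that the eigenvalues of $A$ are disjoint from those of $S$ and of its Kronecker sums $S\oplus_k S$ for $k\ge 2$. Let $V_1\in\mathbb{R}^{n\times r}$ and $V_2\in\mathbb{R}^{n\times r^2}$ be the solutions of the Sylvester equations $$V_1S-AV_1=BL_1,\qquad V_2(S\oplus S)-AV_2=BL_2,$$ and let $W\in\mathbb{R}^{n\times r}$ be chosen so that $W^\top V_1$ is invertible. Construct the reduced-order model (ROM) from $V_1,V_2,W$ as defined in the context, and suppose that the eigenvalues of $A_r$ are disjoint from those of $S$ and of $S\oplus_k S$ for $k\ge2$. Let $\Pi(\omega)$ be the center manifold of the full-order model, i.e. the unique, analytic solution of the full-order invariance equation given in the context, and let $\pi_r(\omega)$ be the center manifold of the ROM, i.e. the solution, in a neighbourhood of $0$, of the ROM invariance equation given in the context. Then the center manifold $\pi_r(\omega)$ of the ROM maps to the center manifold $\Pi(\omega)$ of the full-order model under the map $$\Pi(\omega)=V_1\,\pi_r(\omega)+V_2\left(\pi_r(\omega)\otimes\pi_r(\omega)\right).$$ Moreover, the nonlinear moment $\widehat{\mathcal{M}}$ of the ROM matches the nonlinear moment $\mathcal{M}$ of the full-order model, i.e. $$\mathcal{M}(\omega)=\widehat{\mathcal{M}}(\omega)$$ for all $\omega$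 in a neighbourhood of $\omega=0$.
   Context: $\otimes$ is the Kronecker product; $\omega^{(2)}=\omega\otimes\omega$. For $S\in\mathbb{R}^{r\times r}$ and $k\ge1$, $S\oplus_k S=\sum_{j=1}^{k} I_r^{(j-1)}\otimes S\otimes I_r^{(k-j)}$, where $I_r^{(i)}$ is the $i$-fold Kronecker power of $I_r$ (with $I_r^{(0)}=1$); $S\oplus S:=S\oplus_2 S=S\otimes I_r+I_r\otimes S$. $\partial/\partial\omega$ denotes the Jacobian matrix. Full-order model (FOM): $\dot x=Ax+Bu$, $y=Cx$. Signal generator: $\dot\omega=S\omega$, $u=L_1\omega+L_2\omega^{(2)}$. FOM invariance equation, for a map $\Pi$ with values in $\mathbb{R}^n$ and $\Pi(0)=0$: $$\frac{\partial\Pi(\omega)}{\partial\omega}S\omega=A\Pi(\omega)+B(L_1\omega+L_2\omega^{(2)}).$$ The nonlinear moment of the FOM is $\mathcal{M}(\omega)=C\,\Pi(\omega)$. Quadratic ROM built from $V_1,V_2,W$ (with $W^\top V_1$ invertible): $M_r(x_r)\dot x_r=A_rx_r+H_r(x_r\otimes x_r)+B_ru$, $\;y_r=C_rx_r+K_r(x_r\otimes x_r)$, with $x_r\in\mathbb{R}^r$ and $$A_r=(W^\top V_1)^{-1}W^\top AV_1,\quad B_r=(W^\top V_1)^{-1}W^\top B,\quad H_r=(W^\top V_1)^{-1}W^\top AV_2,$$ $$E_r=(W^\top V_1)^{-1}W^\top V_2,\quad M_r(x_r)=I_r+E_r(I_r\otimes x_r+x_r\otimes I_r),\quad C_r=CV_1,\quad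 K_r=CV_2 .$$ ROM invariance equation, for a map $\pi_r$ from a neighbourhood of $0\in\mathbb{R}^r$ to $\mathbb{R}^r$ with $\pi_r(0)=0$: $$M_r(\pi_r(\omega))\,\frac{\partial\pi_r(\omega)}{\partial\omega}\,S\omega=A_r\pi_r(\omega)+H_r(\pi_r(\omega)\otimes\pi_r(\omega))+B_r(L_1\omega+L_2\omega^{(2)}).$$ The nonlinear moment of the ROM is $\widehat{\mathcal{M}}(\omega)=C_r\pi_r(\omega)+K_r(\pi_r(\omega)\otimes\pi_r(\omega))$.
   Formalization: The center manifold π_r of the ROM is taken to be a real analytic solution near 0 (as Π is); non-analytic solutions can exist, e.g. π_r = ω + |ω|^3.5 for S = 1, A = A_r = 3.5, and for them the claim fails. *)

theory Defs
  imports "HOL-Analysis.Analysis"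
begin

section \<open>Kronecker products\<close>

text \<open>
  The rows or columns of a Kronecker product are indexed by pairs \<open>(i, j)\<close>, which in lexicographic
  order give the usual numbering. Vectors in $R^{r^2}$ are thus of type \<open>real^('r \<times> 'r)\<close>.
\<close>

definition vec_kron :: "'a::times^'m \<Rightarrow> 'a^'n \<Rightarrow> 'a^('m \<times> 'n)"  (infixl \<open>\<otimes>\<^sub>v\<close> 75)
  where "x \<otimes>\<^sub>v y = (\<chi> p. x $ fst p * y $ snd p)"

definition mat_kron :: "'a::times^'n^'m \<Rightarrow> 'a^'q^'p \<Rightarrow> 'a^('n \<times> 'q)^('m \<times> 'p)"  (infixl \<open>\<otimes>\<^sub>m\<close> 75)
  where "M \<otimes>\<^sub>m N = (\<chi> p q. M $ fst p $ fst q * N $ snd p $ snd q)"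

text \<open>
  A matrix times a column vector, and a column vector times a matrix. The column index of the
  product, which would be a pair with one trivial component, is identified with that of the matrix.
\<close>

definition mat_vec_kron :: "'a::times^'n^'m \<Rightarrow> 'a^'p \<Rightarrow> 'a^'n^('m \<times> 'p)"  (infixl \<open>\<otimes>\<^sub>m\<^sub>v\<close> 75)
  where "M \<otimes>\<^sub>m\<^sub>v x = (\<chi> p k. M $ fst p $ k * x $ snd p)"

definition vec_mat_kron :: "'a::times^'p \<Rightarrow> 'a^'n^'m \<Rightarrow> 'a^'n^('p \<times> 'm)"  (infixl \<open>\<otimes>\<^sub>v\<^sub>m\<close> 75)
  where "x \<otimes>\<^sub>v\<^sub>m M = (\<chi> p k. x $ fst p * M $ snd p $ k)"

definition kron_sum :: "real^'r^'r \<Rightarrow> real^('r \<times> 'r)^('r \<times> 'r)"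
  where "kron_sum S = S \<otimes>\<^sub>m mat 1 + mat 1 \<otimes>\<^sub>m S"

section \<open>The \<open>k\<close>-fold Kronecker sum\<close>

text \<open>
  As \<open>k\<close> varies, so does the size $r^k$, and no single matrix type accommodates this. A square
  matrix of size $r^k$ is therefore represented by a function on pairs of words of length \<open>k\<close> over
  the index type \<open>'r\<close>; its values at words of other lengths are irrelevant.
\<close>

type_synonym 'r word_matrix = "'r list \<Rightarrow> 'r list \<Rightarrow> real"

definition words :: "nat \<Rightarrow> 'r list set"
  where "words k = {xs. length xs = k}"

definition word_mat :: "real^'r^'r \<Rightarrow> 'r word_matrix"
  where "word_mat S xs ys = S $ hd xs $ hd ys"

text \<open>The Kronecker product of \<open>M\<close>, indexed by words of length \<open>l\<close>, with \<open>N\<close>.\<close>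

definition word_kron :: "nat \<Rightarrow> 'r word_matrix \<Rightarrow> 'r word_matrix \<Rightarrow> 'r word_matrix"
  where "word_kron l M N xs ys = M (take l xs) (take l ys) * N (drop l xs) (drop l ys)"

fun id_kron_power :: "nat \<Rightarrow> 'r::finite word_matrix"
  where
    "id_kron_power 0 = (\<lambda>xs ys. 1)"
  | "id_kron_power (Suc i) = word_kron i (id_kron_power i) (word_mat (mat 1))"

definition kron_sum_k :: "nat \<Rightarrow> real^'r^'r \<Rightarrow> 'r::finite word_matrix"
  where "kron_sum_k k S xs ys =
    (\<Sum>j=1..k. word_kron j (word_kron (j - 1) (id_kron_power (j - 1)) (word_mat S))
       (id_kron_power (k - j)) xs ys)"

section \<open>Eigenvalues\<close>

text \<open>The complex eigenvalues of a real square matrix with finite index set \<open>I\<close>.\<close>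

definition eigenvalues_on :: "'i set \<Rightarrow> ('i \<Rightarrow> 'i \<Rightarrow> real) \<Rightarrow> complex set"
  where "eigenvalues_on I M =
    {l. \<exists>v :: 'i \<Rightarrow> complex. (\<exists>i\<in>I. v i \<noteq> 0) \<and>
          (\<forall>i\<in>I. (\<Sum>j\<in>I. complex_of_real (M i j) * v j) = l * v i)}"

definition eigenvalues :: "real^'n^'n \<Rightarrow> complex set"
  where "eigenvalues A = eigenvalues_on UNIV (\<lambda>i j. A $ i $ j)"

definition eigenvalues_kron_sum :: "nat \<Rightarrow> real^'r^'r \<Rightarrow> complex set"
  where "eigenvalues_kron_sum k S = eigenvalues_on (words k) (kron_sum_k k S)"

definition kron_nonresonant :: "real^'n^'n \<Rightarrow> real^'r^'r \<Rightarrow> bool"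
  where "kron_nonresonant A S \<longleftrightarrow>
    eigenvalues A \<inter> eigenvalues S = {} \<and>
    (\<forall>k\<ge>2. eigenvalues A \<inter> eigenvalues_kron_sum k S = {})"

lemma eigenvalues_iff:
  "l \<in> eigenvalues A \<longleftrightarrow> (\<exists>v. v \<noteq> 0 \<and> map_matrix complex_of_real A *v v = l *s v)"
proof -
  have "(\<exists>v. v \<noteq> 0 \<and> map_matrix complex_of_real A *v v = l *s v) \<longleftrightarrow>
    (\<exists>f. (\<chi> i. f i) \<noteq> 0 \<and> map_matrix complex_of_real A *v (\<chi> i. f i) = l *s (\<chi> i. f i))"
    by (metis vec_nth_inverse)
  then show ?thesis
    by (simp add: eigenvalues_def eigenvalues_on_def vec_eq_iff matrix_vector_mult_def)
qed

lemma kron_sum_k_1: "kron_sum_k 1 S [a] [b] = S $ a $ b"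
  by (simp add: kron_sum_k_def word_kron_def word_mat_def)

lemma kron_sum_k_2: "kron_sum_k 2 S [a, b] [c, d] = kron_sum S $ (a, b) $ (c, d)"
  by (simp add: kron_sum_k_def word_kron_def word_mat_def kron_sum_def mat_kron_def
      numeral_2_eq_2)

section \<open>Real analytic maps\<close>

text \<open>
  Near each point of \<open>U\<close> the map is the sum of an (unconditionally convergent) power series, with
  coefficients \<open>c \<alpha>\<close> indexed by the multi-indices \<open>\<alpha> :: 'r \<Rightarrow> nat\<close>.
\<close>

definition real_analytic_on :: "(real^'r \<Rightarrow> real^'n) \<Rightarrow> (real^'r) set \<Rightarrow> bool"
  where "real_analytic_on f U \<longleftrightarrow>
    (\<forall>a\<in>U. \<exists>e>0. \<exists>c :: ('r \<Rightarrow> nat) \<Rightarrow> real^'n. \<forall>x\<in>ball a e.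
       ((\<lambda>\<alpha>. (\<Prod>i\<in>UNIV. (x $ i - a $ i) ^ \<alpha> i) *\<^sub>R c \<alpha>) has_sum f x) UNIV)"

section \<open>Full-order model\<close>

text \<open>
  The signal generator is \<open>\<omega>' = S \<omega>\<close>, \<open>u = L1 \<omega> + L2 (\<omega> \<otimes> \<omega>)\<close>. Center manifolds are local objects:
  the defining equations are required on some open neighbourhood of the origin.
\<close>

definition signal_output :: "real^'r^'m \<Rightarrow> real^('r \<times> 'r)^'m \<Rightarrow> real^'r \<Rightarrow> real^'m"
  where "signal_output L1 L2 \<omega> = L1 *v \<omega> + L2 *v (\<omega> \<otimes>\<^sub>v \<omega>)"

definition fom_center_manifold ::
  "real^'n^'n \<Rightarrow> real^'m^'n \<Rightarrow> real^'r^'r \<Rightarrow> real^'r^'m \<Rightarrow> real^('r \<times> 'r)^'m \<Rightarrow>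
   (real^'r \<Rightarrow> real^'n) \<Rightarrow> bool"
  where "fom_center_manifold A B S L1 L2 P \<longleftrightarrow>
    (\<exists>U. open U \<and> 0 \<in> U \<and> real_analytic_on P U \<and> P 0 = 0 \<and>
      (\<forall>\<omega>\<in>U. jacobian P (at \<omega>) *v (S *v \<omega>) = A *v P \<omega> + B *v signal_output L1 L2 \<omega>))"

definition fom_moment :: "real^'n^'p \<Rightarrow> (real^'r \<Rightarrow> real^'n) \<Rightarrow> real^'r \<Rightarrow> real^'p"
  where "fom_moment C P \<omega> = C *v P \<omega>"

section \<open>Reduced-order model\<close>

definition proj_mat :: "real^'r^'n \<Rightarrow> real^'r^'n \<Rightarrow> real^'n^'r"
  where "proj_mat W V1 = matrix_inv (transpose W ** V1) ** transpose W"

definition rom_A :: "real^'r^'n \<Rightarrow> real^'r^'n \<Rightarrow> real^'n^'n \<Rightarrow> real^'r^'r"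
  where "rom_A W V1 A = proj_mat W V1 ** A ** V1"

definition rom_B :: "real^'r^'n \<Rightarrow> real^'r^'n \<Rightarrow> real^'m^'n \<Rightarrow> real^'m^'r"
  where "rom_B W V1 B = proj_mat W V1 ** B"

definition rom_H ::
  "real^'r^'n \<Rightarrow> real^'r^'n \<Rightarrow> real^('r \<times> 'r)^'n \<Rightarrow> real^'n^'n \<Rightarrow> real^('r \<times> 'r)^'r"
  where "rom_H W V1 V2 A = proj_mat W V1 ** A ** V2"

definition rom_E ::
  "real^'r^'n \<Rightarrow> real^'r^'n \<Rightarrow> real^('r \<times> 'r)^'n \<Rightarrow> real^('r \<times> 'r)^'r"
  where "rom_E W V1 V2 = proj_mat W V1 ** V2"

definition rom_M :: "real^('r \<times> 'r)^'r \<Rightarrow> real^'r \<Rightarrow> real^'r^'r"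
  where "rom_M Er x = mat 1 + Er ** (mat 1 \<otimes>\<^sub>m\<^sub>v x + x \<otimes>\<^sub>v\<^sub>m mat 1)"

definition rom_C :: "real^'r^'n \<Rightarrow> real^'n^'p \<Rightarrow> real^'r^'p"
  where "rom_C V1 C = C ** V1"

definition rom_K :: "real^('r::finite \<times> 'r)^'n \<Rightarrow> real^'n^'p \<Rightarrow> real^('r \<times> 'r)^'p"
  where "rom_K V2 C = C ** V2"

definition rom_center_manifold ::
  "real^'r^'r \<Rightarrow> real^'m^'r \<Rightarrow> real^('r \<times> 'r)^'r \<Rightarrow> real^('r \<times> 'r)^'r \<Rightarrow>
   real^'r^'r \<Rightarrow> real^'r^'m \<Rightarrow> real^('r \<times> 'r)^'m \<Rightarrow> (real^'r \<Rightarrow> real^'r) \<Rightarrow> bool"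
  where "rom_center_manifold Ar Br Hr Er S L1 L2 p \<longleftrightarrow>
    (\<exists>U. open U \<and> 0 \<in> U \<and> real_analytic_on p U \<and> p 0 = 0 \<and>
      (\<forall>\<omega>\<in>U. rom_M Er (p \<omega>) *v (jacobian p (at \<omega>) *v (S *v \<omega>)) =
        Ar *v p \<omega> + Hr *v (p \<omega> \<otimes>\<^sub>v p \<omega>) + Br *v signal_output L1 L2 \<omega>))"

definition rom_moment ::
  "real^'r^'p \<Rightarrow> real^('r \<times> 'r)^'p \<Rightarrow> (real^'r \<Rightarrow> real^'r) \<Rightarrow> real^'r \<Rightarrow> real^'p"
  where "rom_moment Cr Kr p \<omega> = Cr *v p \<omega> + Kr *v (p \<omega> \<otimes>\<^sub>v p \<omega>)"

end

(* After subtracting the expected solution, V1 w + V2 (w kron w) for the full-order model and w for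
   the reduced-order model (the two Sylvester equations say that these solve the invariance
   equations), the difference d is analytic at 0 and satisfies d'(w) S w = A d(w), respectively the
   same equation with A_r up to an error of higher order in w. Its leading homogeneous part, of
   degree k, then satisfies this equation exactly. Regard it as a symmetric k-linear form T; by the
   equation, T intertwines the k-fold Kronecker sum of S with A, and T = 0 since A has no
   eigenvalue that is a sum of k eigenvalues of S. Hence d = 0 near 0, so pi_r(w) = w there. *)

theory Submission
  imports Defs "HOL-Computational_Algebra.Fundamental_Theorem_Algebra"
begin

section \<open>Symmetric multilinear forms\<close>

text \<open>One uniqueness statement serves both models. The mass matrix of the reduced-order model
  multiplies the unknown derivative, so the error contains the derivative of d along S w as well as
  d itself. An error bound of the form C |w| (|d(w)| + |d'(w) S w|) admits both and is harmless:
  once the forms of degree below k vanish, d and its derivative along S w have order at least k. For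
  the full-order model C = 0. Degree 0 must be removed by d(0) = 0, because the empty sum of
  eigenvalues is 0, which may be an eigenvalue of A. Since S need not be diagonalisable,
  eigenvectors are too few to test T on. Every vector is, however, killed by a product of factors S
  - \<mu> with eigenvalues \<mu>, and this is why the forms are complexified. What enters about the
  Kronecker sums is that their spectrum contains all sums of k eigenvalues of S.\<close>

definition bump :: "'i \<Rightarrow> ('i \<Rightarrow> nat) \<Rightarrow> 'i \<Rightarrow> nat"
  where "bump i \<alpha> = \<alpha>(i := Suc (\<alpha> i))"

lemma bump_same: "bump i \<alpha> i = Suc (\<alpha> i)"
  by (simp add: bump_def)

lemma bump_commute: "bump i (bump j \<alpha>) = bump j (bump i \<alpha>)"
  by (auto simp: bump_def)

lemma sum_bump: "sum (bump i \<alpha>) UNIV = Suc (sum \<alpha> UNIV)" for i :: "'r::finite"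
  by (simp add: bump_def sum.remove[of UNIV i])

text \<open>
  A symmetric \<open>k\<close>-linear form on $\mathbb{K}^r$ is encoded by its values \<open>t \<alpha>\<close> at tuples of standard basis
  vectors, where the multi-index \<open>\<alpha>\<close> counts how often each basis vector occurs. The degree \<open>k\<close> is
  the length of the argument list, so one family \<open>t\<close> encodes a form of every degree.
\<close>

fun multiform :: "(('r::finite \<Rightarrow> nat) \<Rightarrow> 'a::field^'n) \<Rightarrow> ('a^'r) list \<Rightarrow> 'a^'n"
  where
    "multiform t [] = t (\<lambda>_. 0)"
  | "multiform t (v # vs) = (\<Sum>i\<in>UNIV. v $ i *s multiform (\<lambda>\<alpha>. t (bump i \<alpha>)) vs)"

lemma multiform_cong:
  assumes "\<And>\<alpha>. sum \<alpha> UNIV = length vs \<Longrightarrow> s \<alpha> = t \<alpha>"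
  shows "multiform s vs = multiform t vs"
  using assms
proof (induction vs arbitrary: s t)
  case (Cons v vs)
  have "multiform (\<lambda>\<alpha>. s (bump i \<alpha>)) vs = multiform (\<lambda>\<alpha>. t (bump i \<alpha>)) vs" for i
    by (rule Cons.IH) (simp add: Cons.prems sum_bump)
  then show ?case by simp
qed simp

lemma multiform_add: "multiform (\<lambda>\<alpha>. s \<alpha> + t \<alpha>) vs = multiform s vs + multiform t vs"
  by (induction vs arbitrary: s t) (simp_all add: vector_add_ldistrib sum.distrib)

lemma multiform_scale: "multiform (\<lambda>\<alpha>. c *s t \<alpha>) vs = c *s multiform t vs"
  by (induction vs arbitrary: t) (simp_all add: vec.scale_sum_right mult.commute)

lemma multiform_zero: "multiform (\<lambda>\<alpha>. 0) vs = 0"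
  by (induction vs) simp_all

lemma multiform_sum:
  "finite I \<Longrightarrow> multiform (\<lambda>\<alpha>. \<Sum>i\<in>I. t i \<alpha>) vs = (\<Sum>i\<in>I. multiform (t i) vs)"
  by (induction I rule: finite_induct) (simp_all add: multiform_zero multiform_add)

lemma matrix_vector_mult_sum: "A *v (\<Sum>i\<in>I. f i) = (\<Sum>i\<in>I. A *v f i)"
  for A :: "'a::field^'m^'n"
  by (induction I rule: infinite_finite_induct) (simp_all add: matrix_vector_right_distrib)

lemma multiform_matrix: "multiform (\<lambda>\<alpha>. A *v t \<alpha>) vs = A *v multiform t vs"
  by (induction vs arbitrary: t) (simp_all add: matrix_vector_mult_sum vec.scale)

text \<open>Symmetry is built into the encoding: bumps commute, so exchanging two arguments only
  exchanges two sums.\<close>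

lemma multiform_swap: "multiform t (u # v # vs) = multiform t (v # u # vs)"
  by (simp add: vec.scale_sum_right)
    (subst sum.swap, simp add: bump_commute mult.commute)

lemma multiform_update_add:
  "l < length vs \<Longrightarrow>
    multiform t (vs[l := a + b]) = multiform t (vs[l := a]) + multiform t (vs[l := b])"
  by (induction vs arbitrary: t l)
    (auto simp: vector_sadd_rdistrib vector_add_ldistrib sum.distrib split: nat.split)

lemma multiform_update_scale:
  "l < length vs \<Longrightarrow> multiform t (vs[l := c *s a]) = c *s multiform t (vs[l := a])"
  by (induction vs arbitrary: t l)
    (auto simp: vec.scale_sum_right mult_ac split: nat.split)

lemma multiform_eq_0_if_slot_0:
  assumes "l < length vs" "vs ! l = 0"
  shows "multiform t vs = 0"
  using multiform_update_scale[OF assms(1), of t 0 0] assms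
  by (simp add: list_update_same_conv[THEN iffD2])

text \<open>
  The coefficients of the form obtained by applying \<open>S\<close> to one argument at a time and summing over
  the arguments; on the diagonal this is the derivative of \<open>multiform t (replicate k x)\<close> in
  direction \<open>S x\<close>. Where \<open>\<alpha> j - 1\<close> is truncated, the factor \<open>\<alpha> j\<close> vanishes.
\<close>

definition lie :: "'a::field^'r^'r \<Rightarrow> (('r::finite \<Rightarrow> nat) \<Rightarrow> 'a^'n) \<Rightarrow> ('r \<Rightarrow> nat) \<Rightarrow> 'a^'n"
  where "lie S t \<alpha> =
    (\<Sum>j\<in>UNIV. \<Sum>i\<in>UNIV. (of_nat (\<alpha> j) * S $ i $ j) *s t (bump i (\<alpha>(j := \<alpha> j - 1))))"

text \<open>A Leibniz rule: a further argument, the basis vector \<open>m\<close>, gives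
  \<open>S\<close> a further slot to act on. The factor \<open>bump m \<alpha> m\<close> splits
  accordingly, with 1 for the new slot and \<open>\<alpha> m\<close> for the old ones.\<close>

lemma lie_bump:
  "lie S t (bump m \<alpha>) = (\<Sum>i\<in>UNIV. S $ i $ m *s t (bump i \<alpha>)) + lie S (\<lambda>\<alpha>. t (bump m \<alpha>)) \<alpha>"
proof -
  let ?f = "\<lambda>j i. (of_nat (\<alpha> j) * S $ i $ j) *s t (bump m (bump i (\<alpha>(j := \<alpha> j - 1))))"
  have "(of_nat (bump m \<alpha> j) * S $ i $ j) *s t (bump i ((bump m \<alpha>)(j := bump m \<alpha> j - 1))) =
      (if j = m then S $ i $ m *s t (bump i \<alpha>) else 0) + ?f j i" for j i
  proof (cases "j = m")
    case True
    have eq: "(bump m \<alpha>)(j := bump m \<alpha> j - 1) = \<alpha>"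
      using True by (auto simp: bump_def)
    \<comment> \<open>If \<open>\<alpha> m = 0\<close>, lowering and bumping at \<open>m\<close> do
      not cancel, but then the factor \<open>\<alpha> m\<close> removes the term.\<close>
    show ?thesis
    proof (cases "\<alpha> m = 0")
      case False
      have "bump m (bump i (\<alpha>(j := \<alpha> j - 1))) = bump i (bump m (\<alpha>(j := \<alpha> j - 1)))"
        by (rule bump_commute)
      also have "bump m (\<alpha>(j := \<alpha> j - 1)) = \<alpha>"
        using True False by (auto simp: bump_def)
      finally have b: "bump m (bump i (\<alpha>(j := \<alpha> j - 1))) = bump i \<alpha>" .
      show ?thesis
        unfolding eq b using True
        by (simp add: bump_same distrib_right vector_sadd_rdistrib)
    qed (unfold eq, use True in \<open>simp add: bump_same\<close>)
  next
    case False
    have eq: "(bump m \<alpha>)(j := bump m \<alpha> j - 1) = bump m (\<alpha>(j := \<alpha> j - 1))"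
      using False by (auto simp: bump_def)
    show ?thesis
      unfolding eq bump_commute[of i m] using False by (simp add: bump_def)
  qed
  moreover have "(\<Sum>j\<in>UNIV. \<Sum>i\<in>UNIV. if j = m then S $ i $ m *s t (bump i \<alpha>) else 0) =
      (\<Sum>i\<in>UNIV. S $ i $ m *s t (bump i \<alpha>))"
    by (subst sum.swap) simp
  ultimately show ?thesis
    by (simp add: lie_def sum.distrib)
qed

text \<open>Induction along the arguments: \<open>lie_bump\<close> separates the term in which
  \<open>S\<close> acts on the head from those in which it acts on the tail.\<close>

lemma multiform_lie:
  "multiform (lie S t) vs = (\<Sum>l<length vs. multiform t (vs[l := S *v vs ! l]))"
proof (induction vs arbitrary: t)
  case Nil
  then show ?case by (simp add: lie_def)
next
  case (Cons v vs)
  have "multiform (lie S t) (v # vs) =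
      (\<Sum>m\<in>UNIV. v $ m *s multiform (\<lambda>\<alpha>. \<Sum>i\<in>UNIV. S $ i $ m *s t (bump i \<alpha>)) vs) +
      (\<Sum>m\<in>UNIV. v $ m *s multiform (lie S (\<lambda>\<alpha>. t (bump m \<alpha>))) vs)"
    by (simp add: lie_bump multiform_add vector_add_ldistrib sum.distrib)
  also have "(\<Sum>m\<in>UNIV. v $ m *s multiform (\<lambda>\<alpha>. \<Sum>i\<in>UNIV. S $ i $ m *s t (bump i \<alpha>)) vs) =
      multiform t ((S *v v) # vs)"
    by (simp add: multiform_sum multiform_scale vec.scale_sum_right matrix_vector_mult_def
        vec.scale_sum_left mult.commute) (rule sum.swap)
  also have "(\<Sum>m\<in>UNIV. v $ m *s multiform (lie S (\<lambda>\<alpha>. t (bump m \<alpha>))) vs) =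
      (\<Sum>l<length vs. multiform t (v # vs[l := S *v vs ! l]))"
    by (simp add: Cons.IH vec.scale_sum_right) (rule sum.swap)
  finally show ?case
    by (simp add: sum.lessThan_Suc_shift del: multiform.simps(2) sum.lessThan_Suc)
qed

text \<open>The list is a polynomial in factored form that kills \<open>v\<close> at
  \<open>S\<close>. It stands in for a decomposition into generalised eigenvectors and is consumed
  from the head, one factor at a time.\<close>

definition annihilates :: "'a::field^'r^'r \<Rightarrow> 'a list \<Rightarrow> 'a^'r \<Rightarrow> bool"
  where "annihilates S \<mu>s v \<longleftrightarrow> foldl (\<lambda>w \<mu>. S *v w - \<mu> *s w) v \<mu>s = 0"

definition eigval :: "'a::field^'n^'n \<Rightarrow> 'a \<Rightarrow> bool"
  where "eigval A \<mu> \<longleftrightarrow> (\<exists>v. v \<noteq> 0 \<and> A *v v = \<mu> *s v)"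

text \<open>
  If each argument \<open>v\<^sub>l\<close> is an eigenvector of \<open>S\<close> for \<open>\<mu>\<^sub>l\<close>, then the value of the form is an eigenvector
  of \<open>A\<close> for $\sum_l \mu_l$ or zero. In general each \<open>v\<^sub>l\<close> is killed by a product of factors
  \<open>S - \<mu>\<close>, and by induction on their total number the form vanishes once some \<open>v\<^sub>l\<close> is replaced by
  \<open>(S - \<mu>\<^sub>l) v\<^sub>l\<close>, so the same computation applies.
\<close>

lemma multiform_eq_0:
  assumes lie: "\<And>\<alpha>. sum \<alpha> UNIV = k \<Longrightarrow> lie S t \<alpha> = A *v t \<alpha>"
    and nonres: "\<And>\<mu>s. length \<mu>s = k \<Longrightarrow> (\<And>\<mu>. \<mu> \<in> set \<mu>s \<Longrightarrow> eigval S \<mu>) \<Longrightarrow> \<not> eigval A (sum_list \<mu>s)"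
    and "length vs = k" "length \<mu>ss = k"
    and "\<And>l. l < k \<Longrightarrow> annihilates S (\<mu>ss ! l) (vs ! l)"
    and "\<And>l \<mu>. l < k \<Longrightarrow> \<mu> \<in> set (\<mu>ss ! l) \<Longrightarrow> eigval S \<mu>"
  shows "multiform t vs = 0"
  using assms(3-)
proof (induction "sum_list (map length \<mu>ss)" arbitrary: vs \<mu>ss rule: less_induct)
  case less
  show ?case
  proof (cases "\<exists>l<k. \<mu>ss ! l = []")
    case True
    then obtain l where l: "l < k" "\<mu>ss ! l = []" by blast
    then have "vs ! l = 0"
      using less.prems(3)[of l] by (simp add: annihilates_def)
    then show ?thesis
      using l less.prems(1) by (intro multiform_eq_0_if_slot_0[of l]) simp_all
  next
    case False
    have upd: "multiform t (vs[l := S *v vs ! l]) = hd (\<mu>ss ! l) *s multiform t vs" if l: "l < k" for l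
    proof -
      let ?\<mu> = "hd (\<mu>ss ! l)"
      let ?w = "S *v vs ! l - ?\<mu> *s vs ! l"
      obtain ms where ms: "\<mu>ss ! l = ?\<mu> # ms"
        using False l by (metis list.collapse)
      have lm: "length (\<mu>ss ! l) = Suc (length ms)"
        by (subst ms) simp
      have len: "sum_list (map length (\<mu>ss[l := ms])) < sum_list (map length \<mu>ss)"
      proof -
        have "sum_list (map length \<mu>ss) = (\<Sum>i<k. length (\<mu>ss ! i))"
          and "sum_list (map length (\<mu>ss[l := ms])) = (\<Sum>i<k. length (\<mu>ss[l := ms] ! i))"
          using less.prems(2) by (simp_all add: sum_list_sum_nth atLeast0LessThan)
        moreover have "(\<Sum>i<k. length (\<mu>ss[l := ms] ! i)) < (\<Sum>i<k. length (\<mu>ss ! i))"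
        proof (rule sum_strict_mono_ex1)
          show "\<forall>i\<in>{..<k}. length (\<mu>ss[l := ms] ! i) \<le> length (\<mu>ss ! i)"
            using less.prems(2) l lm by (auto simp: nth_list_update)
          show "\<exists>i\<in>{..<k}. length (\<mu>ss[l := ms] ! i) < length (\<mu>ss ! i)"
            by (rule bexI[of _ l]) (use less.prems(2) l in \<open>simp_all add: lm\<close>)
        qed simp
        ultimately show ?thesis by simp
      qed
      have "multiform t (vs[l := ?w]) = 0"
      proof (rule less.hyps[OF len])
        fix i assume i: "i < k"
        have "annihilates S ms ?w"
          using less.prems(3)[OF l] by (subst (asm) ms) (simp add: annihilates_def)
        then show "annihilates S (\<mu>ss[l := ms] ! i) (vs[l := ?w] ! i)"
          using less.prems(1,2) less.prems(3)[OF i] i l by (cases "i = l") simp_all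
        show "eigval S \<mu>" if "\<mu> \<in> set (\<mu>ss[l := ms] ! i)" for \<mu>
        proof (cases "i = l")
          case True
          then have "\<mu> \<in> set (\<mu>ss ! l)"
            using that less.prems(2) l by (subst ms) simp
          then show ?thesis using less.prems(4) l by blast
        next
          case False
          then show ?thesis using that less.prems(4)[OF i] by simp
        qed
      qed (simp_all add: less.prems(1,2))
      moreover have "S *v vs ! l = ?w + ?\<mu> *s vs ! l"
        by simp
      ultimately show ?thesis
        using l less.prems(1) multiform_update_add[of l vs t ?w "?\<mu> *s vs ! l"]
          multiform_update_scale[of l vs t ?\<mu> "vs ! l"]
        by simp
    qed
    have "A *v multiform t vs = multiform (lie S t) vs"
      unfolding multiform_matrix[symmetric]
      by (rule multiform_cong) (simp add: lie less.prems(1))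
    also have "\<dots> = (\<Sum>l<k. hd (\<mu>ss ! l)) *s multiform t vs"
      using less.prems(1) by (simp add: multiform_lie upd vec.scale_sum_left)
    also have "(\<Sum>l<k. hd (\<mu>ss ! l)) = sum_list (map hd \<mu>ss)"
      using less.prems(2) by (simp add: sum_list_sum_nth atLeast0LessThan)
    finally have "A *v multiform t vs = sum_list (map hd \<mu>ss) *s multiform t vs" .
    moreover have "\<not> eigval A (sum_list (map hd \<mu>ss))"
    proof (rule nonres)
      fix \<mu> assume "\<mu> \<in> set (map hd \<mu>ss)"
      then obtain l where "l < k" "\<mu> = hd (\<mu>ss ! l)"
        using less.prems(2) by (auto simp: in_set_conv_nth)
      then show "eigval S \<mu>"
        using False less.prems(4)[of l \<mu>] hd_in_set[of "\<mu>ss ! l"] by auto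
    qed (simp add: less.prems(2))
    ultimately show ?thesis
      unfolding eigval_def by (cases "multiform t vs = 0") auto
  qed
qed

section \<open>Nonresonance\<close>

definition poly_apply :: "'a::field poly \<Rightarrow> 'a^'r^'r \<Rightarrow> 'a^'r \<Rightarrow> 'a^'r"
  where "poly_apply p S v = (\<Sum>i\<le>degree p. coeff p i *s ((*v) S ^^ i) v)"

lemma poly_apply_altdef:
  "degree p \<le> n \<Longrightarrow> poly_apply p S v = (\<Sum>i\<le>n. coeff p i *s ((*v) S ^^ i) v)"
  unfolding poly_apply_def by (rule sum.mono_neutral_left) (auto simp: coeff_eq_0)

lemma poly_apply_mult_linear:
  "poly_apply ([:-\<mu>, 1:] * q) S v = S *v poly_apply q S v - \<mu> *s poly_apply q S v"
proof -
  let ?n = "degree q" and ?p = "[:-\<mu>, 1:] * q"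
  have deg: "degree ?p \<le> Suc ?n"
    using degree_mult_le[of "[:-\<mu>, 1:]" q] by simp
  have co: "coeff ?p i = (case i of 0 \<Rightarrow> 0 | Suc j \<Rightarrow> coeff q j) - \<mu> * coeff q i" for i
    by (simp add: coeff_pCons split: nat.split)
  have "poly_apply ?p S v =
      (\<Sum>i\<le>Suc ?n. (case i of 0 \<Rightarrow> 0 | Suc j \<Rightarrow> coeff q j) *s ((*v) S ^^ i) v) -
      (\<Sum>i\<le>Suc ?n. (\<mu> * coeff q i) *s ((*v) S ^^ i) v)"
    unfolding poly_apply_altdef[OF deg] co sum_subtractf[symmetric]
    by (rule sum.cong) (simp_all only: vec.scale_left_diff_distrib)
  also have "(\<Sum>i\<le>Suc ?n. (case i of 0 \<Rightarrow> 0 | Suc j \<Rightarrow> coeff q j) *s ((*v) S ^^ i) v) =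
      S *v poly_apply q S v"
    by (subst sum.atMost_Suc_shift) (simp add: poly_apply_def matrix_vector_mult_sum vec.scale)
  also have "(\<Sum>i\<le>Suc ?n. (\<mu> * coeff q i) *s ((*v) S ^^ i) v) = \<mu> *s poly_apply q S v"
    by (subst poly_apply_altdef[of q "Suc ?n"]) (simp_all add: vec.scale_sum_right vec.scale_right_distrib)
  finally show ?thesis .
qed

lemma poly_apply_commute:
  "poly_apply p S (S *v v - \<mu> *s v) = S *v poly_apply p S v - \<mu> *s poly_apply p S v"
proof -
  have "((*v) S ^^ i) (S *v v - \<mu> *s v) = S *v ((*v) S ^^ i) v - \<mu> *s ((*v) S ^^ i) v" for i
    by (induction i) (simp_all add: matrix_vector_mult_diff_distrib vec.scale)
  then show ?thesis
    by (simp add: poly_apply_def matrix_vector_mult_sum vec.scale vec.scale_sum_right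
        sum_subtractf[symmetric] vec.scale_right_diff_distrib mult.commute)
qed

text \<open>Induction on the degree, splitting off a root \<mu>. If \<mu> is an eigenvalue, its
  factor is applied to \<open>v\<close> and recorded in the list; otherwise \<open>S - \<mu>\<close>
  is injective and the factor can be cancelled. So the list holds eigenvalues only, although
  \<open>p\<close> may have other roots.\<close>

lemma exists_annihilating_list_if_poly_apply_0:
  fixes S :: "complex^'r^'r"
  assumes "p \<noteq> 0" "poly_apply p S v = 0"
  shows "\<exists>\<mu>s. annihilates S \<mu>s v \<and> (\<forall>\<mu>\<in>set \<mu>s. eigval S \<mu>)"
  using assms
proof (induction "degree p" arbitrary: p v)
  case 0
  then obtain c where "p = [:c:]" "c \<noteq> 0"
    by (metis degree_eq_zeroE pCons_0_0)
  with 0 have "v = 0"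
    by (simp add: poly_apply_def)
  then show ?case
    by (intro exI[of _ "[]"]) (simp add: annihilates_def)
next
  case (Suc n)
  then have "\<not> constant (poly p)"
    by (simp add: constant_degree)
  then obtain \<mu> where "poly p \<mu> = 0"
    using fundamental_theorem_of_algebra by blast
  then obtain q where p: "p = [:-\<mu>, 1:] * q"
    by (metis poly_eq_0_iff_dvd dvdE)
  then have q0: "q \<noteq> 0"
    using Suc.prems(1) by auto
  then have "degree p = Suc (degree q)"
    unfolding p by (subst degree_mult_eq) simp_all
  with q0 Suc.hyps(2) have q: "q \<noteq> 0" "n = degree q"
    by simp_all
  have pa: "S *v poly_apply q S v - \<mu> *s poly_apply q S v = 0"
    using Suc.prems(2) by (simp only: p poly_apply_mult_linear)
  show ?case
  proof (cases "eigval S \<mu>")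
    case True
    have "poly_apply q S (S *v v - \<mu> *s v) = 0"
      using pa by (simp add: poly_apply_commute)
    from Suc.hyps(1)[OF q(2,1) this] obtain \<mu>s
      where "annihilates S \<mu>s (S *v v - \<mu> *s v)" "\<forall>\<mu>\<in>set \<mu>s. eigval S \<mu>" by blast
    with True show ?thesis
      by (intro exI[of _ "\<mu> # \<mu>s"]) (simp add: annihilates_def)
  next
    case False
    have "S *v poly_apply q S v = \<mu> *s poly_apply q S v"
      using pa by simp
    with False have "poly_apply q S v = 0"
      by (auto simp: eigval_def)
    from Suc.hyps(1)[OF q(2,1) this] show ?thesis .
  qed
qed

text \<open>The \<open>CARD('r) + 1\<close> iterates of \<open>v\<close> under \<open>S\<close>
  satisfy a linear relation, whose coefficients become those of \<open>p\<close>.\<close>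

lemma exists_annihilating_poly:
  fixes S :: "'a::field^'r^'r"
  shows "\<exists>p. p \<noteq> 0 \<and> poly_apply p S v = 0"
proof -
  let ?f = "\<lambda>i. ((*v) S ^^ i) v"
  let ?I = "{..CARD('r)}"
  have "\<exists>a. (\<exists>i\<in>?I. a i \<noteq> 0) \<and> (\<Sum>i\<in>?I. a i *s ?f i) = 0"
  proof (cases "inj_on ?f ?I")
    case True
    have "vec.dependent (?f ` ?I)"
    proof (rule ccontr)
      assume "vec.independent (?f ` ?I)"
      then have "card (?f ` ?I) \<le> vec.dim (UNIV :: ('a^'r) set)"
        by (intro vec.independent_card_le_dim) auto
      then show False
        unfolding vec_dim_card using True by (subst (asm) card_image) simp_all
    qed
    then obtain u where u: "\<exists>w\<in>?f ` ?I. u w \<noteq> 0" "(\<Sum>w\<in>?f ` ?I. u w *s w) = 0"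
      unfolding vec.dependent_finite[OF finite_imageI[OF finite_atMost]] by blast
    show ?thesis
      by (rule exI[of _ "u \<circ> ?f"]) (use u in \<open>auto simp: sum.reindex[OF True]\<close>)
  next
    \<comment> \<open>Dependence of the set of iterates does not see repetitions; here the relation
      is the difference of two equal iterates.\<close>
    case False
    then obtain i j where ij: "i \<in> ?I" "j \<in> ?I" "i \<noteq> j" "?f i = ?f j"
      by (auto simp: inj_on_def)
    let ?a = "\<lambda>l. (if l = i then 1 else 0) - (if l = j then 1 else 0)"
    have "(\<Sum>l\<in>?I. ?a l *s ?f l) =
        (\<Sum>l\<in>?I. if l = i then ?f l else 0) - (\<Sum>l\<in>?I. if l = j then ?f l else 0)"
      unfolding sum_subtractf[symmetric] by (rule sum.cong) (auto simp: vec.scale_left_diff_distrib)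
    also have "\<dots> = 0"
      using ij by (simp add: sum.delta)
    finally show ?thesis
      using ij by (intro exI[of _ ?a]) auto
  qed
  then obtain a i where a: "i \<in> ?I" "a i \<noteq> 0" "(\<Sum>i\<in>?I. a i *s ?f i) = 0"
    by blast
  let ?p = "\<Sum>i\<in>?I. monom (a i) i"
  have co: "coeff ?p j = (if j \<in> ?I then a j else 0)" for j
    by (simp add: coeff_sum sum.delta del: atMost_iff)
  have "degree ?p \<le> CARD('r)"
    by (rule degree_le) (simp add: co)
  then have "poly_apply ?p S v = (\<Sum>i\<in>?I. a i *s ?f i)"
    by (subst poly_apply_altdef) (auto simp: co intro!: sum.cong)
  moreover have "?p \<noteq> 0"
    using a co by (metis coeff_0)
  ultimately show ?thesis
    using a by metis
qed

lemma exists_annihilating_list: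
  fixes S :: "complex^'r^'r"
  shows "\<exists>\<mu>s. annihilates S \<mu>s v \<and> (\<forall>\<mu>\<in>set \<mu>s. eigval S \<mu>)"
  using exists_annihilating_poly exists_annihilating_list_if_poly_apply_0 by blast

text \<open>The eigenvector is the Kronecker product \<open>u\<close> of the eigenvectors
  \<open>v l\<close>, as a function on words: one summand of the Kronecker sum acts on the factor
  \<open>v j\<close> alone and multiplies \<open>u\<close> by \<open>\<mu>s ! j\<close>.\<close>

lemma sum_list_eigval_kron_sum:
  fixes S :: "real^'r^'r"
  assumes "length \<mu>s = k" and "\<And>\<mu>. \<mu> \<in> set \<mu>s \<Longrightarrow> eigval (map_matrix complex_of_real S) \<mu>"
  shows "sum_list \<mu>s \<in> eigenvalues_kron_sum k S"
proof -
  have "\<forall>l. \<exists>v. l < k \<longrightarrow> v \<noteq> 0 \<and> map_matrix complex_of_real S *v v = (\<mu>s ! l) *s v"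
    using assms by (auto simp: eigval_def)
  then obtain v where v: "\<And>l. l < k \<Longrightarrow> v l \<noteq> 0"
    and eig: "\<And>l. l < k \<Longrightarrow> map_matrix complex_of_real S *v v l = (\<mu>s ! l) *s v l"
    by metis
  define u where "u xs = (\<Prod>l<k. v l $ (xs ! l))" for xs
  have "\<forall>l. \<exists>i. l < k \<longrightarrow> v l $ i \<noteq> 0"
    using v by (metis vec_eq_iff zero_index)
  then obtain i where i: "\<And>l. l < k \<Longrightarrow> v l $ i l \<noteq> 0"
    by metis
  have idk: "id_kron_power n xs ys = (if xs = ys then 1 else 0)"
    if "length xs = n" "length ys = n" for n and xs ys :: "'r list"
    using that
  proof (induction n arbitrary: xs ys)
    case (Suc n)
    then obtain as a bs b where "xs = as @ [a]" "ys = bs @ [b]" "length as = n" "length bs = n"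
      by (metis length_Suc_conv_rev)
    then show ?case
      by (simp add: word_kron_def word_mat_def mat_def Suc.IH)
  qed simp
  \<comment> \<open>Summand number \<open>Suc j\<close> is the identity in every letter but the one
    at position \<open>j\<close>; the condition says that \<open>xs\<close> and \<open>ys\<close>
    agree off \<open>j\<close>.\<close>
  have entry: "word_kron (Suc j) (word_kron j (id_kron_power j) (word_mat S))
      (id_kron_power (k - Suc j)) xs ys = (if ys = xs[j := ys ! j] then S $ (xs ! j) $ (ys ! j) else 0)"
    if "length xs = k" "length ys = k" "j < k" for j and xs ys :: "'r list"
  proof -
    have "ys = xs[j := ys ! j] \<longleftrightarrow> take j xs = take j ys \<and> drop (Suc j) xs = drop (Suc j) ys"
      using that id_take_nth_drop[of j ys] upd_conv_take_nth_drop[of j xs "ys ! j"]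
      by (metis append_eq_append_conv length_take list.inject)
    then show ?thesis
      using that by (simp add: word_kron_def word_mat_def idk hd_drop_conv_nth min_def take_drop)
  qed
  have eigen: "(\<Sum>ys\<in>words k. complex_of_real (kron_sum_k k S xs ys) * u ys) = sum_list \<mu>s * u xs"
    if xs: "xs \<in> words k" for xs
  proof -
    have len: "length xs = k"
      using xs by (simp add: words_def)
    have fin: "finite (words k :: 'r list set)"
      using finite_lists_length_eq[of "UNIV :: 'r set" k] by (simp add: words_def)
    have "(\<Sum>ys\<in>words k. complex_of_real (kron_sum_k k S xs ys) * u ys) =
        (\<Sum>ys\<in>words k. \<Sum>j<k. if ys = xs[j := ys ! j] then complex_of_real (S $ (xs ! j) $ (ys ! j)) * u ys else 0)"
    proof (rule sum.cong)
      fix ys :: "'r list" assume "ys \<in> words k"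
      then have "length ys = k" by (simp add: words_def)
      have "kron_sum_k k S xs ys = (\<Sum>j<k. if ys = xs[j := ys ! j] then S $ (xs ! j) $ (ys ! j) else 0)"
        unfolding kron_sum_k_def
      proof (rule sum.reindex_bij_witness[of _ Suc "\<lambda>j. j - 1"])
        fix j assume "j \<in> {1..k}"
        then obtain i where i: "j = Suc i" "i < k"
          by (cases j) auto
        show "(if ys = xs[j - 1 := ys ! (j - 1)] then S $ (xs ! (j - 1)) $ (ys ! (j - 1)) else 0) =
            word_kron j (word_kron (j - 1) (id_kron_power (j - 1)) (word_mat S)) (id_kron_power (k - j)) xs ys"
          using entry[OF len \<open>length ys = k\<close> i(2)] by (simp add: i(1))
      qed auto
      then show "complex_of_real (kron_sum_k k S xs ys) * u ys =
          (\<Sum>j<k. if ys = xs[j := ys ! j] then complex_of_real (S $ (xs ! j) $ (ys ! j)) * u ys else 0)"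
        by (simp add: sum_distrib_right if_distrib if_distribR cong: if_cong)
    qed simp
    also have "\<dots> = (\<Sum>j<k. \<Sum>ys\<in>words k.
        if ys = xs[j := ys ! j] then complex_of_real (S $ (xs ! j) $ (ys ! j)) * u ys else 0)"
      by (rule sum.swap)
    \<comment> \<open>The words that agree with \<open>xs\<close> off position \<open>j\<close> are
      parametrised by their letter \<open>a\<close> there.\<close>
    also have "\<dots> = (\<Sum>j<k. \<Sum>a\<in>UNIV. complex_of_real (S $ (xs ! j) $ a) * u (xs[j := a]))"
    proof (rule sum.cong)
      fix j assume j: "j \<in> {..<k}"
      have "(\<Sum>ys\<in>words k. if ys = xs[j := ys ! j] then complex_of_real (S $ (xs ! j) $ (ys ! j)) * u ys else 0)
         = (\<Sum>ys\<in>{ys\<in>words k. ys = xs[j := ys ! j]}. complex_of_real (S $ (xs ! j) $ (ys ! j)) * u ys)"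
        using fin by (simp add: sum.If_cases Int_def)
      also have "\<dots> = (\<Sum>a\<in>UNIV. complex_of_real (S $ (xs ! j) $ a) * u (xs[j := a]))"
        by (rule sum.reindex_bij_witness[of _ "\<lambda>a. xs[j := a]" "\<lambda>ys. ys ! j"])
          (use j len in \<open>auto simp: words_def\<close>)
      finally show "(\<Sum>ys\<in>words k. if ys = xs[j := ys ! j] then complex_of_real (S $ (xs ! j) $ (ys ! j)) * u ys else 0)
         = (\<Sum>a\<in>UNIV. complex_of_real (S $ (xs ! j) $ a) * u (xs[j := a]))" .
    qed simp
    also have "\<dots> = (\<Sum>j<k. \<mu>s ! j * u xs)"
    proof (rule sum.cong)
      fix j assume j: "j \<in> {..<k}"
      let ?r = "\<Prod>l\<in>{..<k} - {j}. v l $ (xs ! l)"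
      have "u (xs[j := a]) = v j $ a * ?r" for a
        unfolding u_def using j len by (simp add: prod.remove[of _ j])
      then have "(\<Sum>a\<in>UNIV. complex_of_real (S $ (xs ! j) $ a) * u (xs[j := a])) =
          (map_matrix complex_of_real S *v v j) $ (xs ! j) * ?r"
        by (simp add: matrix_vector_mult_def sum_distrib_right mult.assoc)
      also have "\<dots> = \<mu>s ! j * (v j $ (xs ! j) * ?r)"
        using j by (simp add: eig)
      also have "v j $ (xs ! j) * ?r = u xs"
        unfolding u_def using j by (simp add: prod.remove[of _ j])
      finally show "(\<Sum>a\<in>UNIV. complex_of_real (S $ (xs ! j) $ a) * u (xs[j := a])) = \<mu>s ! j * u xs" .
    qed simp
    also have "\<dots> = sum_list \<mu>s * u xs"
      using assms(1) by (simp add: sum_list_sum_nth atLeast0LessThan sum_distrib_right)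
    finally show ?thesis .
  qed
  \<comment> \<open>Each \<open>v l\<close> is nonzero at the letter \<open>i l\<close>, so
    \<open>u\<close> is nonzero at the word made of these letters.\<close>
  have "map i [0..<k] \<in> words k" "u (map i [0..<k]) \<noteq> 0"
    using i by (auto simp: words_def u_def)
  then show ?thesis
    unfolding eigenvalues_kron_sum_def eigenvalues_on_def using eigen by blast
qed

lemma eigenvalues_eq_eigval: "\<mu> \<in> eigenvalues A \<longleftrightarrow> eigval (map_matrix complex_of_real A) \<mu>"
  by (simp add: eigenvalues_iff eigval_def)

lemma kron_nonresonant_sum_list:
  assumes "kron_nonresonant A S" "length \<mu>s = k" "k \<ge> 1"
    and "\<And>\<mu>. \<mu> \<in> set \<mu>s \<Longrightarrow> eigval (map_matrix complex_of_real S) \<mu>"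
  shows "\<not> eigval (map_matrix complex_of_real A) (sum_list \<mu>s)"
proof (cases "k = 1")
  case True
  then obtain \<mu> where "\<mu>s = [\<mu>]"
    using assms(2) by (metis One_nat_def length_0_conv length_Suc_conv)
  then show ?thesis
    using assms unfolding kron_nonresonant_def by (auto simp: eigenvalues_eq_eigval[symmetric])
next
  case False
  then show ?thesis
    using assms(1,3) sum_list_eigval_kron_sum[OF assms(2,4)] eigenvalues_eq_eigval[of "sum_list \<mu>s" A]
    unfolding kron_nonresonant_def by (metis IntI One_nat_def Suc_1 empty_iff le_antisym not_less_eq_eq)
qed

section \<open>Complexification of real vectors and forms\<close>

definition cvec :: "real^'n \<Rightarrow> complex^'n"
  where "cvec v = (\<chi> i. complex_of_real (v $ i))"

lemma cvec_0 [simp]: "cvec 0 = 0"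
  by (simp add: cvec_def vec_eq_iff)

lemma cvec_eq_0_iff [simp]: "cvec v = 0 \<longleftrightarrow> v = 0"
  by (simp add: cvec_def vec_eq_iff)

lemma cvec_add: "cvec (u + v) = cvec u + cvec v"
  by (simp add: cvec_def vec_eq_iff)

lemma cvec_sum: "cvec (\<Sum>i\<in>I. f i) = (\<Sum>i\<in>I. cvec (f i))"
  by (induction I rule: infinite_finite_induct) (simp_all add: cvec_add)

lemma cvec_scale: "cvec (c *s v) = complex_of_real c *s cvec v"
  by (simp add: cvec_def vec_eq_iff)

lemma cvec_mult: "cvec (A *v v) = map_matrix complex_of_real A *v cvec v"
  by (simp add: cvec_def vec_eq_iff matrix_vector_mult_def)

lemma multiform_cvec: "multiform (\<lambda>\<alpha>. cvec (t \<alpha>)) (map cvec vs) = cvec (multiform t vs)"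
  by (induction vs arbitrary: t) (simp_all add: cvec_sum cvec_scale, simp add: cvec_def)

lemma lie_cvec: "lie (map_matrix complex_of_real S) (\<lambda>\<alpha>. cvec (t \<alpha>)) \<alpha> = cvec (lie S t \<alpha>)"
  by (simp add: lie_def cvec_sum cvec_scale)

text \<open>Lists of eigenvalues that annihilate a vector are available over the complex numbers, so
  the form is complexified; \<open>cvec\<close> vanishes only at 0, so the conclusion descends to
  real arguments.\<close>

lemma multiform_eq_0_if_nonresonant:
  assumes nonres: "kron_nonresonant A S" and k: "k \<ge> 1"
    and lie: "\<And>\<alpha>. sum \<alpha> UNIV = k \<Longrightarrow> lie S t \<alpha> = A *v t \<alpha>"
    and len: "length vs = k"
  shows "multiform t vs = 0"
proof -
  let ?S = "map_matrix complex_of_real S"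
  obtain f where f: "\<And>v. annihilates ?S (f v) v" "\<And>v \<mu>. \<mu> \<in> set (f v) \<Longrightarrow> eigval ?S \<mu>"
    using exists_annihilating_list[of ?S] by metis
  have "multiform (\<lambda>\<alpha>. cvec (t \<alpha>)) (map cvec vs) = 0"
  proof (rule multiform_eq_0[of k ?S _ "map_matrix complex_of_real A" _ "map f (map cvec vs)"])
    show "lie ?S (\<lambda>\<alpha>. cvec (t \<alpha>)) \<alpha> = map_matrix complex_of_real A *v cvec (t \<alpha>)"
      if "sum \<alpha> UNIV = k" for \<alpha>
      by (simp add: lie_cvec lie[OF that] cvec_mult)
    show "\<not> eigval (map_matrix complex_of_real A) (sum_list \<mu>s)"
      if "length \<mu>s = k" "\<And>\<mu>. \<mu> \<in> set \<mu>s \<Longrightarrow> eigval ?S \<mu>" for \<mu>s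
      by (rule kron_nonresonant_sum_list[OF nonres that(1) k that(2)])
    show "annihilates ?S (map f (map cvec vs) ! l) (map cvec vs ! l)" if "l < k" for l
      using that len by (simp add: f(1))
    show "eigval ?S \<mu>" if "l < k" "\<mu> \<in> set (map f (map cvec vs) ! l)" for l \<mu>
      using that len f(2) by simp
  qed (simp_all add: len)
  then show ?thesis
    by (simp add: multiform_cvec)
qed

section \<open>Homogeneous expansions\<close>

lemma multiform_cons_replicate_swap:
  "multiform t (x # h # replicate k x) = multiform t (h # replicate (Suc k) x)"
  by (simp only: multiform_swap[of t x] replicate_Suc)

text \<open>By symmetry the \<open>k\<close> slots contribute equally. At \<open>k = 0\<close> the
  truncated \<open>k - 1\<close> is harmless, as the factor in front is 0.\<close>

lemma has_derivative_multiform_replicate: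
  fixes t :: "('r::finite \<Rightarrow> nat) \<Rightarrow> real^'n"
  shows "((\<lambda>x. multiform t (replicate k x)) has_derivative
    (\<lambda>h. real k *s multiform t (h # replicate (k - 1) x))) (at x)"
proof (induction k arbitrary: t)
  case 0
  then show ?case by simp
next
  case (Suc k)
  let ?t = "\<lambda>i \<alpha>. t (bump i \<alpha>)"
  have "((\<lambda>x. \<Sum>i\<in>UNIV. (x $ i) *\<^sub>R multiform (?t i) (replicate k x)) has_derivative
      (\<lambda>h. \<Sum>i\<in>UNIV. (x $ i) *\<^sub>R (real k *s multiform (?t i) (h # replicate (k - 1) x)) +
        (h $ i) *\<^sub>R multiform (?t i) (replicate k x))) (at x)"
    by (intro has_derivative_sum has_derivative_scaleR Suc.IH
        bounded_linear.has_derivative[OF bounded_linear_vec_nth] has_derivative_ident)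
  moreover have "(\<Sum>i\<in>UNIV. (x $ i) *\<^sub>R (real k *s multiform (?t i) (h # replicate (k - 1) x)) +
      (h $ i) *\<^sub>R multiform (?t i) (replicate k x)) =
      real (Suc k) *s multiform t (h # replicate k x)" for h
  proof -
    have "(\<Sum>i\<in>UNIV. (x $ i) *\<^sub>R (real k *s multiform (?t i) (h # replicate (k - 1) x))) =
        real k *s multiform t (x # h # replicate (k - 1) x)"
      unfolding multiform.simps(2)[of t x]
      by (simp add: scalar_mult_eq_scaleR scaleR_sum_right mult.commute del: multiform.simps)
    also have "\<dots> = real k *s multiform t (h # replicate k x)"
      by (cases k) (simp_all only: multiform_cons_replicate_swap diff_Suc_1 of_nat_0 vec.scale_zero_left)
    finally show ?thesis
      by (simp add: sum.distrib scalar_mult_eq_scaleR scaleR_left_distrib add.commute)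
  qed
  ultimately show ?case
    by (simp add: scalar_mult_eq_scaleR)
qed

lemma sum_abs_le_card_norm: "(\<Sum>i\<in>UNIV. \<bar>v $ i\<bar>) \<le> real CARD('r) * norm v" for v :: "real^'r"
  using sum_bounded_above[of UNIV "\<lambda>i. \<bar>v $ i\<bar>" "norm v"] by (simp add: component_le_norm_cart)

text \<open>The factor \<open>CARD('r)\<close> compares the sum of absolute coordinates with the
  Euclidean norm, once for each argument.\<close>

lemma norm_multiform_le:
  fixes t :: "('r::finite \<Rightarrow> nat) \<Rightarrow> real^'n"
  assumes "\<And>\<alpha>. norm (t \<alpha>) \<le> K * R ^ sum \<alpha> UNIV" "R \<ge> 0"
  shows "norm (multiform t vs) \<le> K * (\<Prod>v\<leftarrow>vs. real CARD('r) * R * norm v)"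
  using assms(1)
proof (induction vs arbitrary: t K)
  case Nil
  show ?case using Nil[of "\<lambda>_. 0"] by simp
next
  case (Cons v vs)
  let ?P = "\<Prod>v\<leftarrow>vs. real CARD('r) * R * norm v"
  have P: "?P \<ge> 0"
    using assms(2) by (induction vs) auto
  have K: "K \<ge> 0"
    using Cons.prems[of "\<lambda>_. 0"] norm_ge_zero[of "t (\<lambda>_. 0)"] by (simp del: norm_ge_zero)
  \<comment> \<open>Bumping raises the degree by one, so the induction hypothesis is used with
    \<open>K * R\<close> for \<open>K\<close>.\<close>
  have "norm (multiform (\<lambda>\<alpha>. t (bump i \<alpha>)) vs) \<le> K * R * ?P" for i
    by (rule Cons.IH) (use Cons.prems[of "bump i _"] in \<open>simp add: sum_bump mult.assoc\<close>)
  then have "norm (multiform t (v # vs)) \<le> (\<Sum>i\<in>UNIV. \<bar>v $ i\<bar> * (K * R * ?P))"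
    unfolding multiform.simps scalar_mult_eq_scaleR
    by (intro sum_norm_le) (simp add: mult_left_mono)
  also have "\<dots> \<le> real CARD('r) * norm v * (K * R * ?P)"
    unfolding sum_distrib_right[symmetric] using K P assms(2)
    by (intro mult_right_mono sum_abs_le_card_norm) simp
  finally show ?case
    by (simp add: mult_ac)
qed

section \<open>Power series coefficients as symmetric forms\<close>

lemma finite_multi_indices: "finite {\<alpha> :: 'r::finite \<Rightarrow> nat. sum \<alpha> UNIV = k}"
proof (rule finite_subset)
  show "{\<alpha> :: 'r \<Rightarrow> nat. sum \<alpha> UNIV = k} \<subseteq> Pi\<^sub>E UNIV (\<lambda>_. {..k})"
    by (auto intro: member_le_sum)
qed (simp add: finite_PiE)

definition monomial :: "real^'r \<Rightarrow> ('r::finite \<Rightarrow> nat) \<Rightarrow> real"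
  where "monomial x \<alpha> = (\<Prod>i\<in>UNIV. x $ i ^ \<alpha> i)"

text \<open>
  The factor is the inverse of the number of words with letter count \<open>\<alpha>\<close>: expanding the form on the
  diagonal yields one term for each word.
\<close>

definition polar_coeff :: "(('r::finite \<Rightarrow> nat) \<Rightarrow> real^'n) \<Rightarrow> ('r \<Rightarrow> nat) \<Rightarrow> real^'n"
  where "polar_coeff c \<alpha> = ((\<Prod>i\<in>UNIV. fact (\<alpha> i)) / fact (sum \<alpha> UNIV)) *\<^sub>R c \<alpha>"

lemma monomial_bump: "monomial x (bump i \<alpha>) = x $ i * monomial x \<alpha>"
  by (simp add: monomial_def bump_def prod.remove[of UNIV i])

text \<open>Fixing one argument as a basis vector gives a polarised family again, with
  \<open>c\<close> shifted and reweighted; this is what lets an induction on the degree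
  close.\<close>

lemma polar_coeff_bump:
  "polar_coeff c (bump i \<alpha>) =
    polar_coeff (\<lambda>\<alpha>. (real (Suc (\<alpha> i)) / real (Suc (sum \<alpha> UNIV))) *\<^sub>R c (bump i \<alpha>)) \<alpha>"
proof -
  have "(\<Prod>j\<in>UNIV. fact (bump i \<alpha> j) :: real) = real (Suc (\<alpha> i)) * (\<Prod>j\<in>UNIV. fact (\<alpha> j))"
    by (simp add: bump_def prod.remove[of UNIV i] algebra_simps)
  then show ?thesis
    by (simp add: polar_coeff_def sum_bump field_simps)
qed

text \<open>Peeling off one argument in coordinate \<open>i\<close> gives the monomial of \<beta>
  the weight \<open>\<beta> i / Suc k\<close>, and over all \<open>i\<close> these weights sum to
  1.\<close>

lemma multiform_polar_coeff:
  fixes c :: "('r::finite \<Rightarrow> nat) \<Rightarrow> real^'n"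
  shows "multiform (polar_coeff c) (replicate k x) = (\<Sum>\<alpha>|sum \<alpha> UNIV = k. monomial x \<alpha> *\<^sub>R c \<alpha>)"
proof (induction k arbitrary: c)
  case 0
  have "{\<alpha> :: 'r \<Rightarrow> nat. \<forall>i. \<alpha> i = 0} = {\<lambda>_. 0}" by auto
  then show ?case by (simp add: polar_coeff_def monomial_def)
next
  case (Suc k)
  let ?g = "\<lambda>i \<beta>. (real (\<beta> i) / real (Suc k)) *\<^sub>R (monomial x \<beta> *\<^sub>R c \<beta>)"
  have "(x $ i) *\<^sub>R multiform (\<lambda>\<alpha>. polar_coeff c (bump i \<alpha>)) (replicate k x) =
      (\<Sum>\<beta>|sum \<beta> UNIV = Suc k. ?g i \<beta>)" for i
  proof -
    have "(x $ i) *\<^sub>R multiform (\<lambda>\<alpha>. polar_coeff c (bump i \<alpha>)) (replicate k x) =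
        (\<Sum>\<alpha>|sum \<alpha> UNIV = k. ?g i (bump i \<alpha>))"
      unfolding polar_coeff_bump Suc.IH scaleR_sum_right
      by (rule sum.cong) (simp_all add: monomial_bump bump_same mult_ac)
    also have "\<dots> = (\<Sum>\<beta>|sum \<beta> UNIV = Suc k \<and> \<beta> i \<noteq> 0. ?g i \<beta>)"
    proof (rule sum.reindex_bij_witness[of _ "\<lambda>\<beta>. \<beta>(i := \<beta> i - 1)" "bump i"])
      fix \<beta> :: "'r \<Rightarrow> nat" assume "\<beta> \<in> {\<beta>. sum \<beta> UNIV = Suc k \<and> \<beta> i \<noteq> 0}"
      then have b: "bump i (\<beta>(i := \<beta> i - 1)) = \<beta>" and s: "sum \<beta> UNIV = Suc k"
        by (auto simp: bump_def)
      show "bump i (\<beta>(i := \<beta> i - 1)) = \<beta>" by (rule b)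
      show "\<beta>(i := \<beta> i - 1) \<in> {\<alpha>. sum \<alpha> UNIV = k}"
        using s sum_bump[of i "\<beta>(i := \<beta> i - 1)"] unfolding b by simp
    next
      fix \<alpha> :: "'r \<Rightarrow> nat"
      show "(bump i \<alpha>)(i := bump i \<alpha> i - 1) = \<alpha>"
        by (auto simp: bump_def)
    qed (auto simp: sum_bump bump_same)
    \<comment> \<open>Multi-indices with \<open>\<beta> i = 0\<close> have weight 0 and are put
      back, so that all \<open>i\<close> share one index set.\<close>
    also have "\<dots> = (\<Sum>\<beta>|sum \<beta> UNIV = Suc k. ?g i \<beta>)"
      by (rule sum.mono_neutral_left) (auto simp: finite_multi_indices)
    finally show ?thesis .
  qed
  then have "multiform (polar_coeff c) (replicate (Suc k) x) =
      (\<Sum>\<beta>|sum \<beta> UNIV = Suc k. \<Sum>i\<in>UNIV. ?g i \<beta>)"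
    by (simp add: scalar_mult_eq_scaleR) (rule sum.swap)
  also have "\<dots> = (\<Sum>\<beta>|sum \<beta> UNIV = Suc k. monomial x \<beta> *\<^sub>R c \<beta>)"
  proof (rule sum.cong)
    fix \<beta> :: "'r \<Rightarrow> nat" assume "\<beta> \<in> {\<beta>. sum \<beta> UNIV = Suc k}"
    then have "(\<Sum>i\<in>UNIV. real (\<beta> i) / real (Suc k)) = 1"
      by (simp add: sum_divide_distrib[symmetric] of_nat_sum[symmetric] del: of_nat_sum)
    then show "(\<Sum>i\<in>UNIV. ?g i \<beta>) = monomial x \<beta> *\<^sub>R c \<beta>"
      by (simp only: scaleR_sum_left[symmetric] scaleR_one)
  qed simp
  finally show ?case .
qed

text \<open>The factor is the inverse of a multinomial coefficient, which is a positive
  integer.\<close>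

lemma norm_polar_coeff_le:
  fixes c :: "('r::finite \<Rightarrow> nat) \<Rightarrow> real^'n"
  shows "norm (polar_coeff c \<alpha>) \<le> norm (c \<alpha>)"
proof -
  have "(\<Prod>i\<in>I. fact (\<alpha> i) :: nat) dvd fact (sum \<alpha> I)" if "finite I" for I :: "'r set"
    using that
  proof (induction I rule: finite_induct)
    case (insert i I)
    then have "(\<Prod>i\<in>insert i I. fact (\<alpha> i) :: nat) dvd fact (\<alpha> i) * fact (sum \<alpha> I)"
      by simp
    also have "\<dots> dvd fact (\<alpha> i + sum \<alpha> I)"
      by (rule fact_fact_dvd_fact)
    finally show ?case using insert by simp
  qed simp
  from dvd_imp_le[OF this[OF finite_class.finite_UNIV]]
  have "real (\<Prod>i\<in>UNIV. fact (\<alpha> i)) \<le> real (fact (sum \<alpha> UNIV))"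
    by (intro of_nat_mono) simp
  then have q1: "(\<Prod>i\<in>UNIV. fact (\<alpha> i) :: real) / fact (sum \<alpha> UNIV) \<le> 1"
    by simp
  have q0: "(\<Prod>i\<in>UNIV. fact (\<alpha> i) :: real) / fact (sum \<alpha> UNIV) \<ge> 0"
    by (simp add: prod_nonneg)
  show ?thesis
    unfolding polar_coeff_def norm_scaleR abs_of_nonneg[OF q0]
    by (rule mult_left_le_one_le[OF norm_ge_zero q0 q1])
qed

text \<open>Partial sums over finite sets containing \<open>X\<close> lie within 1 of
  \<open>s\<close>. A term outside \<open>X\<close> is the difference of two of them, which is where
  the 2 comes from; the terms in \<open>X\<close> are bounded by the sum of their norms.\<close>

lemma has_sum_terms_bounded:
  fixes f :: "'i \<Rightarrow> 'v::real_normed_vector"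
  assumes "(f has_sum s) A"
  shows "\<exists>M. \<forall>i\<in>A. norm (f i) \<le> M"
proof -
  have "\<forall>\<^sub>F F in finite_subsets_at_top A. dist (sum f F) s < 1"
    using assms unfolding has_sum_def by (rule tendstoD) simp
  then obtain X where X: "finite X" "X \<subseteq> A"
    and "\<forall>Y. finite Y \<and> X \<subseteq> Y \<and> Y \<subseteq> A \<longrightarrow> dist (sum f Y) s < 1"
    unfolding eventually_finite_subsets_at_top by (elim exE conjE)
  then have dist: "\<And>Y. finite Y \<Longrightarrow> X \<subseteq> Y \<Longrightarrow> Y \<subseteq> A \<Longrightarrow> dist (sum f Y) s < 1"
    by simp
  have "norm (f i) \<le> (\<Sum>j\<in>X. norm (f j)) + 2" if i: "i \<in> A" for i
  proof (cases "i \<in> X")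
    case True
    then have "norm (f i) \<le> (\<Sum>j\<in>X. norm (f j))"
      using X(1) by (intro member_le_sum) auto
    then show ?thesis by simp
  next
    case False
    then have "f i = sum f (insert i X) - sum f X"
      using X by simp
    then have "norm (f i) \<le> dist (sum f (insert i X)) s + dist (sum f X) s"
      by (metis dist_norm dist_triangle2)
    also have "\<dots> < 2"
      using dist[of "insert i X"] dist[of X] X i by (simp add: subset_insertI)
    finally show ?thesis
      using sum_nonneg[of X "\<lambda>j. norm (f j)"] by simp
  qed
  then show ?thesis by blast
qed

definition expansion_at_0 :: "(real^'r \<Rightarrow> real^'n) \<Rightarrow> bool"
  where "expansion_at_0 f \<longleftrightarrow>
    (\<exists>e>0. \<exists>c. \<forall>x\<in>ball 0 e. ((\<lambda>\<alpha>. monomial x \<alpha> *\<^sub>R c \<alpha>) has_sum f x) UNIV)"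

text \<open>Grouping by degree turns the series over multi-indices into a series of homogeneous
  forms. The geometric bound on the coefficients, a Cauchy estimate, is recorded for termwise
  differentiation.\<close>

lemma homogeneous_expansion:
  fixes f :: "real^'r \<Rightarrow> real^'n"
  assumes "expansion_at_0 f"
  obtains e R t K where "e > 0" "R > 0" "\<And>\<alpha>. norm (t \<alpha>) \<le> K * R ^ sum \<alpha> UNIV"
    "\<And>x. x \<in> ball 0 e \<Longrightarrow> (\<lambda>k. multiform t (replicate k x)) sums f x"
proof -
  obtain e c where e: "e > 0"
    and c: "\<And>x. x \<in> ball 0 e \<Longrightarrow> ((\<lambda>\<alpha>. monomial x \<alpha> *\<^sub>R c \<alpha>) has_sum f x) UNIV"
    using assms unfolding expansion_at_0_def by blast
  \<comment> \<open>Small enough for the vector with all entries \<rho> to lie in the ball. There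
    each monomial is a power of \<rho>, and boundedness of the terms gives the estimate with
    \<open>R = 1 / \<rho>\<close>.\<close>
  define \<rho> where "\<rho> = e / (2 * real CARD('r))"
  have \<rho>: "\<rho> > 0"
    using e by (simp add: \<rho>_def)
  let ?x = "(\<chi> i. \<rho>) :: real^'r"
  have "norm ?x \<le> real CARD('r) * \<rho>"
    using norm_le_l1_cart[of ?x] \<rho> by simp
  also have "\<dots> < e"
    using e by (simp add: \<rho>_def)
  finally have "?x \<in> ball 0 e" by simp
  from has_sum_terms_bounded[OF c[OF this]] obtain K
    where K: "\<And>\<alpha>. norm (monomial ?x \<alpha> *\<^sub>R c \<alpha>) \<le> K" by blast
  have "norm (polar_coeff c \<alpha>) \<le> K * (1 / \<rho>) ^ sum \<alpha> UNIV" for \<alpha>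
  proof -
    have "monomial ?x \<alpha> = \<rho> ^ sum \<alpha> UNIV"
      by (simp add: monomial_def power_sum)
    then have "norm (c \<alpha>) * \<rho> ^ sum \<alpha> UNIV \<le> K"
      using K[of \<alpha>] \<rho> by (simp add: mult.commute)
    then have "norm (c \<alpha>) \<le> K * (1 / \<rho>) ^ sum \<alpha> UNIV"
      using \<rho> by (simp add: field_simps power_one_over)
    then show ?thesis
      using norm_polar_coeff_le order_trans by blast
  qed
  moreover have "(\<lambda>k. multiform (polar_coeff c) (replicate k x)) sums f x" if x: "x \<in> ball 0 e" for x
  proof (rule has_sum_imp_sums)
    let ?B = "\<lambda>k. {\<alpha> :: 'r \<Rightarrow> nat. sum \<alpha> UNIV = k}"
    \<comment> \<open>The multi-indices are the disjoint union of the degree classes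
      \<open>?B k\<close>, and unconditional summation may be regrouped along them.\<close>
    have "inj_on snd (Sigma UNIV ?B)"
      by (auto simp: inj_on_def)
    moreover have "snd ` Sigma UNIV ?B = UNIV"
      by force
    ultimately have "((\<lambda>p. monomial x (snd p) *\<^sub>R c (snd p)) has_sum f x) (Sigma UNIV ?B)"
      using c[OF x] has_sum_reindex[of snd "Sigma UNIV ?B" "\<lambda>\<alpha>. monomial x \<alpha> *\<^sub>R c \<alpha>" "f x"]
      by (simp add: o_def)
    then show "((\<lambda>k. multiform (polar_coeff c) (replicate k x)) has_sum f x) UNIV"
    proof (rule has_sum_Sigma[rotated])
      show "((\<lambda>\<alpha>. monomial x (snd (k, \<alpha>)) *\<^sub>R c (snd (k, \<alpha>))) has_sum
          multiform (polar_coeff c) (replicate k x)) (?B k)" for k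
        by (simp add: multiform_polar_coeff has_sum_finiteI finite_multi_indices)
    qed (rule isUCont_plus)
  qed
  ultimately show thesis
    using that[of e "1 / \<rho>" "polar_coeff c" K] e \<rho> by simp
qed

text \<open>Termwise differentiation, on a ball where one convergent numerical series dominates the
  derivatives of the terms uniformly.\<close>

lemma has_derivative_homogeneous_expansion:
  fixes f :: "real^'r \<Rightarrow> real^'n"
  assumes e: "e > 0" and R: "R > 0" and t: "\<And>\<alpha>. norm (t \<alpha>) \<le> K * R ^ sum \<alpha> UNIV"
    and f: "\<And>x. x \<in> ball 0 e \<Longrightarrow> (\<lambda>k. multiform t (replicate k x)) sums f x"
  obtains \<delta> f' where "\<delta> > 0" "\<delta> \<le> e" "\<And>x. x \<in> ball 0 \<delta> \<Longrightarrow> (f has_derivative f' x) (at x)"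
    "\<And>x h. x \<in> ball 0 \<delta> \<Longrightarrow> (\<lambda>k. real k *s multiform t (h # replicate (k - 1) x)) sums f' x h"
proof -
  define q where "q = real CARD('r) * R"
  \<comment> \<open>On this ball \<open>q * norm x \<le> 1 / 2\<close>, which bounds the derivative
    of the form of degree \<open>k\<close> in direction \<open>h\<close> by
    \<open>b k * norm h\<close>.\<close>
  define \<delta> where "\<delta> = min e (1 / (2 * q))"
  define F where "F k x h = real k *s multiform t (h # replicate (k - 1) x)" for k x h
  define b where "b k = K * q * (real k * (1 / 2) ^ (k - 1))" for k
  define f' where "f' x h = (\<Sum>k. F k x h)" for x h
  have q: "q > 0"
    using R by (simp add: q_def)
  have \<delta>: "\<delta> > 0" "\<delta> \<le> e"
    using e q by (simp_all add: \<delta>_def)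
  have K: "K \<ge> 0"
    using t[of "\<lambda>_. 0"] norm_ge_zero[of "t (\<lambda>_. 0)"] by (simp del: norm_ge_zero)
  have F_le: "norm (F k x h) \<le> b k * norm h" if x: "x \<in> ball 0 \<delta>" for k x h
  proof (cases k)
    case (Suc m)
    have "q * norm x \<le> q * (1 / (2 * q))"
      using x q by (intro mult_left_mono) (simp_all add: \<delta>_def)
    then have "(q * norm x) ^ m \<le> (1 / 2) ^ m"
      using q by (intro power_mono) simp_all
    then have "q * norm h * (q * norm x) ^ m \<le> q * norm h * (1 / 2) ^ m"
      using q by (intro mult_left_mono) simp_all
    then have "K * (q * norm h * (q * norm x) ^ m) \<le> K * (q * norm h * (1 / 2) ^ m)"
      using K by (rule mult_left_mono)
    moreover have "norm (multiform t (h # replicate m x)) \<le> K * (q * norm h * (q * norm x) ^ m)"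
      using norm_multiform_le[OF t less_imp_le[OF R], of "h # replicate m x"]
      by (simp add: prod_list_replicate q_def)
    ultimately have "norm (multiform t (h # replicate m x)) \<le> K * (q * norm h * (1 / 2) ^ m)"
      by linarith
    then have "real k * norm (multiform t (h # replicate m x)) \<le> real k * (K * (q * norm h * (1 / 2) ^ m))"
      by (rule mult_left_mono) simp
    then show ?thesis
      by (simp add: F_def b_def Suc scalar_mult_eq_scaleR mult_ac del: multiform.simps)
  qed (simp add: F_def b_def)
  have "summable (\<lambda>k. real (Suc k) * (1 / 2) ^ k)"
    using geometric_deriv_sums[of "1 / 2 :: real"] by (simp add: sums_iff)
  then have "summable (\<lambda>k. real k * (1 / 2) ^ (k - 1))"
    using summable_Suc_iff[of "\<lambda>k. real k * (1 / 2) ^ (k - 1)"] by simp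
  then have summable_b: "summable b"
    unfolding b_def by (rule summable_mult)
  have summable_norm_F: "summable (\<lambda>k. norm (F k x h))" if "x \<in> ball 0 \<delta>" for x h
    by (rule summable_comparison_test'[OF summable_mult2[OF summable_b, of "norm h"], of 0])
      (simp add: F_le[OF that])
  then have F_sums: "(\<lambda>k. F k x h) sums f' x h" if "x \<in> ball 0 \<delta>" for x h
    unfolding f'_def using that by (intro summable_sums summable_norm_cancel[of "\<lambda>k. F k x h"])
  \<comment> \<open>The theorem on series of derivatives produces some limit \<open>g\<close>,
    identified with \<open>f\<close> afterwards by uniqueness of sums.\<close>
  have "\<exists>g. \<forall>x\<in>ball 0 \<delta>. (\<lambda>k. multiform t (replicate k x)) sums g x \<and>
      (g has_derivative f' x) (at x within ball 0 \<delta>)"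
  proof (rule has_derivative_series)
    show "((\<lambda>x. multiform t (replicate k x)) has_derivative F k x) (at x within ball 0 \<delta>)" for k x
      unfolding F_def by (rule has_derivative_at_withinI[OF has_derivative_multiform_replicate])
    show "\<forall>\<^sub>F n in sequentially. \<forall>x\<in>ball 0 \<delta>. \<forall>h. norm ((\<Sum>k<n. F k x h) - f' x h) \<le> \<epsilon> * norm h"
      if "\<epsilon> > 0" for \<epsilon>
    proof -
      obtain N where N: "\<And>n. n \<ge> N \<Longrightarrow> norm (\<Sum>k. b (k + n)) < \<epsilon>"
        using suminf_exist_split[OF \<open>\<epsilon> > 0\<close> summable_b] by blast
      have "norm ((\<Sum>k<n. F k x h) - f' x h) \<le> \<epsilon> * norm h"
        if n: "n \<ge> N" and x: "x \<in> ball 0 \<delta>" for n x h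
      proof -
        have sn: "summable (\<lambda>k. norm (F (k + n) x h))"
          using summable_norm_F[OF x] by (subst summable_iff_shift)
        have sb: "summable (\<lambda>k. b (k + n))"
          using summable_b by (subst summable_iff_shift)
        have "(\<Sum>k. F (k + n) x h) = f' x h - (\<Sum>k<n. F k x h)"
          unfolding f'_def by (rule suminf_minus_initial_segment[OF sums_summable[OF F_sums[OF x]]])
        then have "norm ((\<Sum>k<n. F k x h) - f' x h) = norm (\<Sum>k. F (k + n) x h)"
          by (simp add: norm_minus_commute)
        also have "\<dots> \<le> (\<Sum>k. norm (F (k + n) x h))"
          by (rule summable_norm[OF sn])
        also have "\<dots> \<le> (\<Sum>k. b (k + n) * norm h)"
          by (rule suminf_le[OF F_le[OF x] sn summable_mult2[OF sb]])
        also have "\<dots> = (\<Sum>k. b (k + n)) * norm h"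
          by (rule suminf_mult2[OF sb, symmetric])
        also have "\<dots> \<le> \<epsilon> * norm h"
          using N[OF n] by (intro mult_right_mono) (simp_all add: abs_le_iff)
        finally show ?thesis .
      qed
      then show ?thesis
        unfolding eventually_sequentially by blast
    qed
    show "(\<lambda>k. multiform t (replicate k 0)) sums f 0"
      by (rule f) (simp add: e)
  qed (simp_all add: \<delta>)
  then obtain g where g: "\<And>x. x \<in> ball 0 \<delta> \<Longrightarrow> (\<lambda>k. multiform t (replicate k x)) sums g x"
    "\<And>x. x \<in> ball 0 \<delta> \<Longrightarrow> (g has_derivative f' x) (at x within ball 0 \<delta>)" by blast
  have fg: "f x = g x" if "x \<in> ball 0 \<delta>" for x
    using sums_unique2[OF f g(1)] that \<delta> by simp
  have "(f has_derivative f' x) (at x)" if x: "x \<in> ball 0 \<delta>" for x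
    using has_derivative_transform[OF x fg g(2)[OF x]] at_within_open[OF x open_ball] by simp
  with F_sums show thesis
    using that[OF \<delta>] unfolding F_def by blast
qed

text \<open>Division by \<open>s ^ k\<close> leaves a power series with constant term
  \<open>a k\<close>, continuous at 0. The argument runs in each coordinate, where the series is
  scalar.\<close>

lemma power_series_leading_coeff:
  fixes a :: "nat \<Rightarrow> real^'n"
  assumes "r > 0" and "\<And>s. s \<noteq> 0 \<Longrightarrow> \<bar>s\<bar> < r \<Longrightarrow> (\<lambda>k. s ^ k *\<^sub>R a k) sums g s"
    and "\<And>j. j < k \<Longrightarrow> a j = 0"
  shows "((\<lambda>s. (1 / s ^ k) *\<^sub>R g s) \<longlongrightarrow> a k) (at 0)"
proof (rule vec_tendstoI)
  fix i
  have "((\<lambda>s. ((1 / s ^ k) *\<^sub>R g s) $ i) \<longlongrightarrow> (\<lambda>n. a (n + k) $ i) 0) (at 0)"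
  proof (rule powser_limit_0_strong[OF \<open>r > 0\<close>])
    fix s :: real assume s: "s \<noteq> 0" "norm s < r"
    have "(\<lambda>n. s ^ (n + k) *\<^sub>R a (n + k)) sums (g s - (\<Sum>j<k. s ^ j *\<^sub>R a j))"
      using assms(2)[of s] s by (intro sums_split_initial_segment) simp
    moreover have "(\<Sum>j<k. s ^ j *\<^sub>R a j) = 0"
      by (simp add: assms(3))
    ultimately have "(\<lambda>n. s ^ (n + k) *\<^sub>R a (n + k)) sums g s" by simp
    then have "(\<lambda>n. (1 / s ^ k) * (s ^ (n + k) *\<^sub>R a (n + k)) $ i) sums ((1 / s ^ k) * g s $ i)"
      by (intro sums_mult bounded_linear.sums[OF bounded_linear_vec_nth])
    then show "(\<lambda>n. a (n + k) $ i * s ^ n) sums (((1 / s ^ k) *\<^sub>R g s) $ i)"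
      using s(1) by (simp add: power_add mult.commute)
  qed
  then show "((\<lambda>s. ((1 / s ^ k) *\<^sub>R g s) $ i) \<longlongrightarrow> a k $ i) (at 0)" by simp
qed

text \<open>Divide the estimate by \<open>s ^ k\<close>. The quotients of \<open>g\<close> and
  \<open>h\<close> converge to \<open>a k\<close> and \<open>b k\<close>, while the remaining factor
  \<open>\<bar>s\<bar>\<close> sends the right side to 0.\<close>

lemma power_series_lowest_order:
  fixes a b :: "nat \<Rightarrow> real^'n"
  assumes r: "r > 0"
    and g: "\<And>s. s \<noteq> 0 \<Longrightarrow> \<bar>s\<bar> < r \<Longrightarrow> (\<lambda>k. s ^ k *\<^sub>R a k) sums g s"
    and h: "\<And>s. s \<noteq> 0 \<Longrightarrow> \<bar>s\<bar> < r \<Longrightarrow> (\<lambda>k. s ^ k *\<^sub>R b k) sums h s"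
    and le: "\<And>s. \<bar>s\<bar> < r \<Longrightarrow> norm (h s - A *v g s) \<le> C * \<bar>s\<bar> * (norm (g s) + norm (h s))"
    and 0: "\<And>j. j < k \<Longrightarrow> a j = 0" "\<And>j. j < k \<Longrightarrow> b j = 0"
  shows "b k = A *v a k"
proof -
  let ?g = "\<lambda>s. (1 / s ^ k) *\<^sub>R g s" and ?h = "\<lambda>s. (1 / s ^ k) *\<^sub>R h s"
  have lim_g: "(?g \<longlongrightarrow> a k) (at 0)" and lim_h: "(?h \<longlongrightarrow> b k) (at 0)"
    using power_series_leading_coeff[OF r g 0(1)] power_series_leading_coeff[OF r h 0(2)] by simp_all
  have "((\<lambda>s. ?h s - A *v ?g s) \<longlongrightarrow> b k - A *v a k) (at 0)"
    by (intro tendsto_diff lim_h bounded_linear.tendsto[OF matrix_vector_mul_bounded_linear] lim_g)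
  moreover have "((\<lambda>s. ?h s - A *v ?g s) \<longlongrightarrow> 0) (at 0)"
  proof (rule Lim_null_comparison)
    have "norm (?h s - A *v ?g s) \<le> C * \<bar>s\<bar> * (norm (?g s) + norm (?h s))" if "\<bar>s\<bar> < r" for s
    proof -
      have "?h s - A *v ?g s = (1 / s ^ k) *\<^sub>R (h s - A *v g s)"
        by (simp add: matrix_vector_mult_scaleR scaleR_diff_right)
      then have "norm (?h s - A *v ?g s) = \<bar>1 / s ^ k\<bar> * norm (h s - A *v g s)"
        by simp
      also have "\<dots> \<le> \<bar>1 / s ^ k\<bar> * (C * \<bar>s\<bar> * (norm (g s) + norm (h s)))"
        by (rule mult_left_mono[OF le[OF that]]) simp
      also have "\<dots> = C * \<bar>s\<bar> * (norm (?g s) + norm (?h s))"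
        unfolding norm_scaleR by (simp only: distrib_left mult_ac)
      finally show ?thesis .
    qed
    then show "\<forall>\<^sub>F s in at 0. norm (?h s - A *v ?g s) \<le> C * \<bar>s\<bar> * (norm (?g s) + norm (?h s))"
      unfolding eventually_at using r by (intro exI[of _ r]) simp
    have "((\<lambda>s. C * \<bar>s\<bar> * (norm (?g s) + norm (?h s))) \<longlongrightarrow> C * \<bar>0\<bar> * (norm (a k) + norm (b k))) (at 0)"
      by (intro tendsto_intros lim_g lim_h)
    then show "((\<lambda>s. C * \<bar>s\<bar> * (norm (?g s) + norm (?h s))) \<longlongrightarrow> 0) (at 0)"
      by simp
  qed
  ultimately have "b k - A *v a k = 0"
    by (rule tendsto_unique[OF trivial_limit_at])
  then show ?thesis by simp
qed

lemma multiform_axis: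
  fixes t :: "('r::finite \<Rightarrow> nat) \<Rightarrow> 'a::field^'n"
  shows "multiform t (axis m 1 # vs) = multiform (\<lambda>\<alpha>. t (bump m \<alpha>)) vs"
proof -
  have "axis m 1 $ i *s v = (if i = m then v else 0)" for i and v :: "'a^'n"
    by (simp add: axis_def)
  then show ?thesis by simp
qed

text \<open>Polarisation by differentiation: if the diagonal vanishes identically, so does its
  derivative in the direction of a basis vector, which up to a nonzero factor is the diagonal of a
  bumped family in one degree less.\<close>

lemma multiform_coeffs_eq_0:
  fixes t :: "('r::finite \<Rightarrow> nat) \<Rightarrow> real^'n"
  assumes "\<And>x. multiform t (replicate k x) = 0" "sum \<alpha> UNIV = k"
  shows "t \<alpha> = 0"
  using assms
proof (induction k arbitrary: t \<alpha>)
  case 0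
  then have "\<alpha> = (\<lambda>_. 0)" by auto
  with 0 show ?case by simp
next
  case (Suc k)
  then obtain m where m: "\<alpha> m \<noteq> 0"
    by (metis Suc_neq_Zero sum.neutral)
  let ?\<beta> = "\<alpha>(m := \<alpha> m - 1)"
  have \<alpha>: "bump m ?\<beta> = \<alpha>"
    using m by (auto simp: bump_def)
  have "(\<lambda>\<alpha>. t (bump m \<alpha>)) ?\<beta> = 0"
  proof (rule Suc.IH[where t = "\<lambda>\<alpha>. t (bump m \<alpha>)" and \<alpha> = ?\<beta>])
    fix x :: "real^'r"
    have "((\<lambda>x. 0) has_derivative (\<lambda>h. real (Suc k) *s multiform t (h # replicate k x))) (at x)"
      using has_derivative_multiform_replicate[of t "Suc k" x] unfolding Suc.prems(1) by simp
    from fun_cong[OF has_derivative_unique[OF this has_derivative_const], of "axis m 1"]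
    have "real (Suc k) *s multiform t (axis m 1 # replicate k x) = 0"
      by (simp only:)
    then show "multiform (\<lambda>\<alpha>. t (bump m \<alpha>)) (replicate k x) = 0"
      unfolding multiform_axis by (simp add: scalar_mult_eq_scaleR)
  next
    show "sum ?\<beta> UNIV = k"
      using sum_bump[of m ?\<beta>] Suc.prems(2) unfolding \<alpha> by simp
  qed
  then show ?case
    unfolding \<alpha> .
qed

lemma multiform_replicate_update:
  "l < k \<Longrightarrow> multiform t ((replicate k x)[l := h]) = multiform t (h # replicate (k - 1) x)"
proof (induction k arbitrary: l t)
  case (Suc k)
  show ?case
  proof (cases l)
    case (Suc l')
    then have "l' < k" using Suc.prems by simp
    then obtain k' where k': "k = Suc k'"
      using not0_implies_Suc by fastforce
    have "multiform t ((replicate (Suc k) x)[l := h]) = multiform t (x # (replicate k x)[l' := h])"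
      by (simp add: Suc)
    also have "\<dots> = multiform t (x # h # replicate (k - 1) x)"
      by (simp only: multiform.simps(2)[of t x] Suc.IH[OF \<open>l' < k\<close>])
    also have "\<dots> = multiform t (h # replicate k x)"
      unfolding k' diff_Suc_1 by (rule multiform_cons_replicate_swap)
    finally show ?thesis by simp
  qed simp
qed simp

lemma multiform_lie_replicate:
  fixes t :: "('r::finite \<Rightarrow> nat) \<Rightarrow> 'a::field^'n"
  shows "multiform (lie S t) (replicate k x) = of_nat k *s multiform t ((S *v x) # replicate (k - 1) x)"
proof -
  have "multiform (lie S t) (replicate k x) =
      (\<Sum>l<k. multiform t ((S *v x) # replicate (k - 1) x))"
    unfolding multiform_lie length_replicate
    by (rule sum.cong) (simp_all only: lessThan_iff nth_replicate multiform_replicate_update)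
  also have "\<dots> = of_nat k *s multiform t ((S *v x) # replicate (k - 1) x)"
  proof -
    have "(\<Sum>l<k. c) = of_nat k *s c" for c :: "'a^'n"
      by (induction k) (simp_all add: vec.scale_left_distrib add.commute del: sum_constant)
    then show ?thesis .
  qed
  finally show ?thesis .
qed

lemma multiform_scale_args: "multiform t (map ((*s) c) vs) = c ^ length vs *s multiform t vs"
  by (induction vs arbitrary: t) (simp_all add: vec.scale_sum_right mult_ac)

lemma multiform_diff: "multiform (\<lambda>\<alpha>. s \<alpha> - t \<alpha>) vs = multiform s vs - multiform t vs"
  by (induction vs arbitrary: s t) (simp_all add: vec.scale_right_diff_distrib sum_subtractf)

text \<open>
  Restricting to rays turns the estimate into one for power series in one variable; its lowest order
  term says that the leading homogeneous part of \<open>d\<close> satisfies \<open>lie S t = A t\<close>.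
\<close>

lemma nonresonant_unique_zero:
  fixes d :: "real^'r \<Rightarrow> real^'n"
  assumes nonres: "kron_nonresonant A S" and d: "expansion_at_0 d" "d 0 = 0"
    and ev: "\<forall>\<^sub>F \<omega> in nhds 0. \<forall>d'. (d has_derivative d') (at \<omega>) \<longrightarrow>
      norm (d' (S *v \<omega>) - A *v d \<omega>) \<le> C * norm \<omega> * (norm (d \<omega>) + norm (d' (S *v \<omega>)))"
  shows "\<forall>\<^sub>F \<omega> in nhds 0. d \<omega> = 0"
proof -
  obtain e R t K where e: "e > 0" and R: "R > 0"
    and t: "\<And>\<alpha>. norm (t \<alpha>) \<le> K * R ^ sum \<alpha> UNIV"
    and sums_d: "\<And>x. x \<in> ball 0 e \<Longrightarrow> (\<lambda>k. multiform t (replicate k x)) sums d x"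
    by (rule homogeneous_expansion[OF d(1)], rule that)
  obtain \<delta> f' where \<delta>: "\<delta> > 0" "\<delta> \<le> e"
    and deriv: "\<And>x. x \<in> ball 0 \<delta> \<Longrightarrow> (d has_derivative f' x) (at x)"
    and sums_f': "\<And>x h. x \<in> ball 0 \<delta> \<Longrightarrow>
      (\<lambda>k. real k *s multiform t (h # replicate (k - 1) x)) sums f' x h"
    by (rule has_derivative_homogeneous_expansion[OF e R t sums_d], assumption, rule that)
  obtain \<rho> where \<rho>: "\<rho> > 0" and le: "\<And>\<omega> d'. norm \<omega> < \<rho> \<Longrightarrow> (d has_derivative d') (at \<omega>) \<Longrightarrow>
      norm (d' (S *v \<omega>) - A *v d \<omega>) \<le> C * norm \<omega> * (norm (d \<omega>) + norm (d' (S *v \<omega>)))"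
    using ev unfolding eventually_nhds_metric by auto
  define \<eta> where "\<eta> = min \<delta> \<rho>"
  have \<eta>: "\<eta> > 0" "\<eta> \<le> \<delta>" "\<eta> \<le> \<rho>"
    using \<delta> \<rho> by (simp_all add: \<eta>_def)
  define a where "a x k = multiform t (replicate k x)" for x k
  define b where "b x k = real k *s multiform t ((S *v x) # replicate (k - 1) x)" for x k
  have a_scale: "a (s *s x) k = s ^ k *\<^sub>R a x k" for s x k
    using multiform_scale_args[of t s "replicate k x"] by (simp add: a_def scalar_mult_eq_scaleR)
  have b_scale: "b (s *s x) k = s ^ k *\<^sub>R b x k" for s x k
  proof (cases k)
    case (Suc m)
    have "map ((*s) s) ((S *v x) # replicate m x) = (S *v (s *s x)) # replicate m (s *s x)"
      by (simp add: vec.scale)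
    with multiform_scale_args[of t s "(S *v x) # replicate m x"] show ?thesis
      by (simp add: b_def Suc scalar_mult_eq_scaleR mult_ac del: multiform.simps)
  qed (simp add: b_def)
  \<comment> \<open>Strong induction on the degree: once all lower forms vanish, \<open>k\<close> is
    the lowest possible order of \<open>d\<close> along every ray.\<close>
  have "multiform t vs = 0" if "length vs = k" for vs k
    using that
  proof (induction k arbitrary: vs rule: less_induct)
    case (less k)
    show ?case
    proof (cases "k = 0")
      case True
      \<comment> \<open>At the origin every form of positive degree has a zero argument, so only the
        constant term remains.\<close>
      have "(\<lambda>k. multiform t (replicate k 0)) = (\<lambda>k. if k = 0 then t (\<lambda>_. 0) else 0)"
        by (rule ext) (simp add: multiform_eq_0_if_slot_0[of 0])
      then have "t (\<lambda>_. 0) = d 0"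
        using sums_d[of 0] e sums_single[of 0 "\<lambda>_. t (\<lambda>_. 0)"] sums_unique2 by fastforce
      then show ?thesis
        using True less.prems d(2) by simp
    next
      case False
      have "b x k = A *v a x k" if x: "norm x < \<eta>" for x
      proof (rule power_series_lowest_order[where r = 1 and g = "\<lambda>s. d (s *s x)"
            and h = "\<lambda>s. f' (s *s x) (S *v (s *s x))" and C = "C * norm x"])
        fix s :: real assume s: "\<bar>s\<bar> < 1"
        have nsx: "norm (s *s x) = \<bar>s\<bar> * norm x"
          by (simp add: scalar_mult_eq_scaleR)
        also have "\<dots> \<le> 1 * norm x"
          using s by (intro mult_right_mono) simp_all
        finally have sx: "norm (s *s x) < \<eta>"
          using x by simp
        then have sx': "s *s x \<in> ball 0 \<delta>" "s *s x \<in> ball 0 e"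
          using \<eta> \<delta> by simp_all
        show "(\<lambda>k. s ^ k *\<^sub>R a x k) sums d (s *s x)"
          unfolding a_scale[symmetric] unfolding a_def by (rule sums_d[OF sx'(2)])
        show "(\<lambda>k. s ^ k *\<^sub>R b x k) sums f' (s *s x) (S *v (s *s x))"
          unfolding b_scale[symmetric] unfolding b_def by (rule sums_f'[OF sx'(1)])
        show "norm (f' (s *s x) (S *v (s *s x)) - A *v d (s *s x)) \<le>
            C * norm x * \<bar>s\<bar> * (norm (d (s *s x)) + norm (f' (s *s x) (S *v (s *s x))))"
          using le[OF _ deriv[OF sx'(1)]] sx \<eta>(3) unfolding nsx by (simp add: mult_ac)
      next
        show "a x j = 0" if "j < k" for j
          unfolding a_def by (rule less.IH[OF that]) simp
        show "b x j = 0" if "j < k" for j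
          unfolding b_def using less.IH[OF that, of "(S *v x) # replicate (j - 1) x"]
          by (cases j) (simp_all del: multiform.simps)
      qed simp
      \<comment> \<open>Both \<open>a\<close> and \<open>b\<close> are homogeneous of degree
        \<open>k\<close> in \<open>x\<close>, so the identity extends from the small ball to all
        \<open>x\<close>.\<close>
      moreover have "\<exists>s>0. norm (s *s x) < \<eta>" for x :: "real^'r"
      proof (intro exI conjI)
        show "\<eta> / (norm x + 1) > 0"
          using \<eta>(1) by (simp add: add_nonneg_pos)
        have "\<eta> * norm x < \<eta> * (norm x + 1)"
          using \<eta>(1) by simp
        then show "norm ((\<eta> / (norm x + 1)) *s x) < \<eta>"
          using \<eta>(1) by (simp add: scalar_mult_eq_scaleR divide_less_eq add_nonneg_pos)
      qed
      ultimately have "b x k = A *v a x k" for x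
      proof -
        obtain s where s: "s > 0" "norm (s *s x) < \<eta>"
          using \<open>\<exists>s>0. norm (s *s x) < \<eta>\<close> by blast
        have "b (s *s x) k = A *v a (s *s x) k"
          using \<open>\<And>x. norm x < \<eta> \<Longrightarrow> b x k = A *v a x k\<close> s(2) by blast
        then show ?thesis
          using s(1) by (simp add: a_scale b_scale matrix_vector_mult_scaleR)
      qed
      then have "multiform (\<lambda>\<alpha>. lie S t \<alpha> - A *v t \<alpha>) (replicate k x) = 0" for x
        unfolding multiform_diff multiform_lie_replicate multiform_matrix a_def b_def by simp
      then have "lie S t \<alpha> = A *v t \<alpha>" if "sum \<alpha> UNIV = k" for \<alpha>
        using multiform_coeffs_eq_0[where t = "\<lambda>\<alpha>. lie S t \<alpha> - A *v t \<alpha>"] that by fastforce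
      then show ?thesis
        using False less.prems by (intro multiform_eq_0_if_nonresonant[OF nonres, of k]) simp_all
    qed
  qed
  then have "d x = 0" if "x \<in> ball 0 e" for x
    using sums_d[OF that] by (simp add: sums_iff)
  then show ?thesis
    unfolding eventually_nhds_metric using e by (intro exI[of _ e]) simp
qed

section \<open>Center manifolds\<close>

lemma bounded_bilinear_vec_kron:
  "bounded_bilinear (vec_kron :: real^'m \<Rightarrow> real^'n \<Rightarrow> real^('m \<times> 'n))"
  unfolding bilinear_conv_bounded_bilinear[symmetric] bilinear_def
  by (auto simp: vec_kron_def vec_eq_iff algebra_simps intro!: linearI)

lemmas vec_kron_simps = bounded_bilinear.add_left[OF bounded_bilinear_vec_kron]
  bounded_bilinear.add_right[OF bounded_bilinear_vec_kron]
  bounded_bilinear.diff_left[OF bounded_bilinear_vec_kron]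
  bounded_bilinear.diff_right[OF bounded_bilinear_vec_kron]

lemma uminus_matrix_vector_mult: "(- M) *v v = - (M *v v)" for M :: "'a::field^'m^'n"
  using matrix_vector_mult_diff_rdistrib[of 0 M v] by simp

lemma sum_UNIV_prod: "(\<Sum>p\<in>UNIV. f p) = (\<Sum>i\<in>UNIV. \<Sum>j\<in>UNIV. f (i, j))"
  by (simp add: sum.cartesian_product)

lemma mult_if_0: "(if b then x else 0) * y = (if b then x * y else 0)"
  "y * (if b then x else 0) = (if b then y * x else 0)" for x y :: real
  by simp_all

text \<open>The Kronecker sum acts as a derivation, which makes the second Sylvester equation a
  statement about the derivative of the quadratic part along \<open>S *v \<omega>\<close>.\<close>

lemma kron_sum_vec_kron: "kron_sum S *v (x \<otimes>\<^sub>v y) = (S *v x) \<otimes>\<^sub>v y + x \<otimes>\<^sub>v (S *v y)"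
proof -
  have "(\<Sum>i\<in>UNIV. \<Sum>j\<in>UNIV. (S $ a $ i * mat 1 $ b $ j + mat 1 $ a $ i * S $ b $ j) * (x $ i * y $ j)) =
      (\<Sum>i\<in>UNIV. S $ a $ i * x $ i) * y $ b + x $ a * (\<Sum>j\<in>UNIV. S $ b $ j * y $ j)" for a b
  proof -
    have "(\<Sum>i\<in>UNIV. \<Sum>j\<in>UNIV. S $ a $ i * mat 1 $ b $ j * (x $ i * y $ j)) =
        (\<Sum>i\<in>UNIV. S $ a $ i * x $ i) * y $ b"
      by (simp add: mat_def mult_if_0 sum_distrib_right sum_distrib_left mult_ac)
    moreover have "(\<Sum>i\<in>UNIV. \<Sum>j\<in>UNIV. mat 1 $ a $ i * S $ b $ j * (x $ i * y $ j)) =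
        x $ a * (\<Sum>j\<in>UNIV. S $ b $ j * y $ j)"
      by (subst sum.swap) (simp add: mat_def mult_if_0 sum_distrib_left mult_ac)
    ultimately show ?thesis
      by (simp add: distrib_right sum.distrib)
  qed
  then show ?thesis
    by (simp add: vec_eq_iff kron_sum_def mat_kron_def vec_kron_def matrix_vector_mult_def sum_UNIV_prod)
qed

text \<open>The right side is the derivative of \<open>x + E *v (x \<otimes>\<^sub>v x)\<close> in
  direction \<open>h\<close>; for \<open>E = rom_E W V1 V2\<close> this map is the projection of the
  quadratic ansatz.\<close>

lemma rom_M_mult: "rom_M E x *v h = h + E *v (h \<otimes>\<^sub>v x + x \<otimes>\<^sub>v h)"
proof -
  have "(mat 1 \<otimes>\<^sub>m\<^sub>v x + x \<otimes>\<^sub>v\<^sub>m mat 1) *v h = h \<otimes>\<^sub>v x + x \<otimes>\<^sub>v h"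
    by (simp add: vec_eq_iff mat_vec_kron_def vec_mat_kron_def vec_kron_def matrix_vector_mult_def
        mat_def distrib_left distrib_right sum.distrib mult_if_0 mult.commute)
  then show ?thesis
    by (simp add: rom_M_def matrix_vector_mult_add_rdistrib matrix_vector_mul_assoc[symmetric])
qed

lemma has_derivative_quadratic:
  fixes V1 :: "real^'r^'n"
  shows "((\<lambda>x. V1 *v x + V2 *v (x \<otimes>\<^sub>v x)) has_derivative
    (\<lambda>h. V1 *v h + V2 *v (x \<otimes>\<^sub>v h + h \<otimes>\<^sub>v x))) (at x)"
  by (intro has_derivative_add bounded_linear.has_derivative[OF matrix_vector_mul_bounded_linear]
      has_derivative_ident bounded_bilinear.FDERIV[OF bounded_bilinear_vec_kron])

lemma jacobian_mult:
  fixes f :: "real^'r \<Rightarrow> real^'n"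
  assumes "(f has_derivative f') (at x)"
  shows "jacobian f (at x) *v h = f' h"
proof -
  have "(f has_derivative (\<lambda>h. jacobian f (at x) *v h)) (at x)"
    using assms jacobian_works differentiable_def by blast
  from has_derivative_unique[OF this assms] show ?thesis
    by (simp add: fun_eq_iff)
qed

section \<open>Maps with a power series at the origin\<close>

lemma expansion_at_0_if_real_analytic_on:
  assumes "real_analytic_on f U" "0 \<in> U"
  shows "expansion_at_0 f"
proof -
  obtain e c where "e > 0"
    "\<forall>x\<in>ball 0 e. ((\<lambda>\<alpha>. (\<Prod>i\<in>UNIV. (x $ i - 0 $ i) ^ \<alpha> i) *\<^sub>R c \<alpha>) has_sum f x) UNIV"
    using assms unfolding real_analytic_on_def by blast
  then show ?thesis
    unfolding expansion_at_0_def monomial_def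
    by (intro exI[of _ e] exI[of _ c] conjI) simp_all
qed

lemma expansion_at_0_add:
  assumes "expansion_at_0 f" "expansion_at_0 g"
  shows "expansion_at_0 (\<lambda>x. f x + g x)"
proof -
  obtain e c where "e > 0" "\<forall>x\<in>ball 0 e. ((\<lambda>\<alpha>. monomial x \<alpha> *\<^sub>R c \<alpha>) has_sum f x) UNIV"
    using assms(1) unfolding expansion_at_0_def by blast
  moreover obtain e' c' where "e' > 0" "\<forall>x\<in>ball 0 e'. ((\<lambda>\<alpha>. monomial x \<alpha> *\<^sub>R c' \<alpha>) has_sum g x) UNIV"
    using assms(2) unfolding expansion_at_0_def by blast
  ultimately show ?thesis
    unfolding expansion_at_0_def
    by (intro exI[of _ "min e e'"] conjI exI[of _ "\<lambda>\<alpha>. c \<alpha> + c' \<alpha>"])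
      (auto simp: scaleR_right_distrib intro!: has_sum_add)
qed

lemma expansion_at_0_monomial: "expansion_at_0 (\<lambda>x. monomial x \<beta> *\<^sub>R v)"
proof -
  have "((\<lambda>\<alpha>. monomial x \<alpha> *\<^sub>R (if \<alpha> = \<beta> then v else 0)) has_sum monomial x \<beta> *\<^sub>R v) UNIV" for x
    by (rule has_sum_finite_neutralI[of "{\<beta>}"]) simp_all
  then show ?thesis
    unfolding expansion_at_0_def
    by (intro exI[of _ 1] conjI exI[of _ "\<lambda>\<alpha>. if \<alpha> = \<beta> then v else 0"]) simp_all
qed

lemma expansion_at_0_sum:
  assumes "\<And>i. i \<in> I \<Longrightarrow> expansion_at_0 (f i)"
  shows "expansion_at_0 (\<lambda>x. \<Sum>i\<in>I. f i x)"
  using assms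
proof (induction I rule: infinite_finite_induct)
  case (insert i I)
  then show ?case by (simp add: expansion_at_0_add)
qed (use expansion_at_0_monomial[of "\<lambda>_. 0" 0] in simp_all)

text \<open>A finite sum of monomial maps with the matrix columns as coefficients. The pairs
  \<open>(i, j)\<close> and \<open>(j, i)\<close> give the same monomial, and summing maps takes
  care of that.\<close>

lemma expansion_at_0_quadratic: "expansion_at_0 (\<lambda>x. V1 *v x + V2 *v (x \<otimes>\<^sub>v x))"
proof -
  have "V1 *v x = (\<Sum>i\<in>UNIV. monomial x (bump i (\<lambda>_. 0)) *\<^sub>R column i V1)" for x
    by (simp add: matrix_mult_sum monomial_bump scalar_mult_eq_scaleR) (simp add: monomial_def)
  moreover have "V2 *v (x \<otimes>\<^sub>v x) =
      (\<Sum>p\<in>UNIV. monomial x (bump (fst p) (bump (snd p) (\<lambda>_. 0))) *\<^sub>R column p V2)" for x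
    by (simp add: matrix_mult_sum monomial_bump scalar_mult_eq_scaleR)
      (simp add: monomial_def vec_kron_def)
  ultimately show ?thesis
    by (simp add: expansion_at_0_add expansion_at_0_sum expansion_at_0_monomial)
qed

lemma expansion_at_0_differentiable:
  assumes "expansion_at_0 f"
  shows "f differentiable (at 0)"
proof -
  obtain e R t K where e: "e > 0" and R: "R > 0"
    and t: "\<And>\<alpha>. norm (t \<alpha>) \<le> K * R ^ sum \<alpha> UNIV"
    and sums: "\<And>x. x \<in> ball 0 e \<Longrightarrow> (\<lambda>k. multiform t (replicate k x)) sums f x"
    by (rule homogeneous_expansion[OF assms], rule that)
  obtain \<delta> f' where "\<delta> > 0" and "\<And>x. x \<in> ball 0 \<delta> \<Longrightarrow> (f has_derivative f' x) (at x)"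
    by (rule has_derivative_homogeneous_expansion[OF e R t sums], assumption, rule that)
  then show ?thesis
    unfolding differentiable_def by (intro exI[of _ "f' 0"]) simp
qed

text \<open>Supplies the factor \<open>norm \<omega>\<close> in the error estimate of the
  reduced-order model. The constant is a bound for the derivative plus 1 for the remainder.\<close>

lemma linear_bound_at_0:
  fixes f :: "'a::real_normed_vector \<Rightarrow> 'b::real_normed_vector"
  assumes "f differentiable (at 0)" "f 0 = 0"
  shows "\<exists>k\<ge>0. \<forall>\<^sub>F x in nhds 0. norm (f x) \<le> k * norm x"
proof -
  obtain f' where f': "(f has_derivative f') (at 0)"
    using assms(1) unfolding differentiable_def by blast
  then obtain k where k: "k \<ge> 0" "\<And>x. norm (f' x) \<le> norm x * k"
    using bounded_linear.nonneg_bounded has_derivative_bounded_linear by blast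
  obtain \<delta> where \<delta>: "\<delta> > 0" "\<And>x. norm x < \<delta> \<Longrightarrow> norm (f x - f' x) \<le> norm x"
    using f' assms(2) unfolding has_derivative_at_alt by (auto dest: spec[of _ "1::real"])
  have "norm (f x) \<le> (k + 1) * norm x" if "norm x < \<delta>" for x
    using norm_triangle_sub[of "f x" "f' x"] \<delta>(2)[OF that] k(2)[of x] by (simp add: algebra_simps)
  then show ?thesis
    using k(1) \<delta>(1) unfolding eventually_nhds_metric
    by (intro exI[of _ "k + 1"]) auto
qed

lemma fom_center_manifold_eq:
  fixes A :: "real^'n^'n" and S :: "real^'r^'r"
  assumes nonres: "kron_nonresonant A S"
    and V1: "V1 ** S - A ** V1 = B ** L1"
    and V2: "V2 ** kron_sum S - A ** V2 = B ** L2"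
    and P: "fom_center_manifold A B S L1 L2 P"
  shows "\<forall>\<^sub>F \<omega> in nhds 0. P \<omega> = V1 *v \<omega> + V2 *v (\<omega> \<otimes>\<^sub>v \<omega>)"
proof -
  let ?Q = "\<lambda>\<omega>. V1 *v \<omega> + V2 *v (\<omega> \<otimes>\<^sub>v \<omega>)"
  obtain U where U: "open U" "0 \<in> U" "real_analytic_on P U" "P 0 = 0"
    and eq: "\<And>\<omega>. \<omega> \<in> U \<Longrightarrow>
      jacobian P (at \<omega>) *v (S *v \<omega>) = A *v P \<omega> + B *v signal_output L1 L2 \<omega>"
    using P unfolding fom_center_manifold_def by blast
  have V1': "V1 *v (S *v x) = A *v (V1 *v x) + B *v (L1 *v x)" for x
    using arg_cong[OF V1, of "\<lambda>M. M *v x"]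
    by (simp add: matrix_vector_mult_diff_rdistrib matrix_vector_mul_assoc[symmetric] algebra_simps)
  have V2': "V2 *v ((S *v x) \<otimes>\<^sub>v x + x \<otimes>\<^sub>v (S *v x)) = A *v (V2 *v (x \<otimes>\<^sub>v x)) + B *v (L2 *v (x \<otimes>\<^sub>v x))" for x
    using arg_cong[OF V2, of "\<lambda>M. M *v (x \<otimes>\<^sub>v x)"]
    by (simp add: matrix_vector_mult_diff_rdistrib matrix_vector_mul_assoc[symmetric]
        kron_sum_vec_kron algebra_simps)
  \<comment> \<open>With \<open>- V1\<close> and \<open>- V2\<close> the difference becomes a sum of
    two maps with known expansions. It solves the linear equation exactly, hence
    \<open>C = 0\<close>.\<close>
  have "\<forall>\<^sub>F \<omega> in nhds 0. P \<omega> + ((- V1) *v \<omega> + (- V2) *v (\<omega> \<otimes>\<^sub>v \<omega>)) = 0"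
  proof (rule nonresonant_unique_zero[OF nonres, where C = 0])
    show "expansion_at_0 (\<lambda>\<omega>. P \<omega> + ((- V1) *v \<omega> + (- V2) *v (\<omega> \<otimes>\<^sub>v \<omega>)))"
      by (intro expansion_at_0_add[OF expansion_at_0_if_real_analytic_on[OF U(3,2)]]
          expansion_at_0_quadratic)
    show "P 0 + ((- V1) *v 0 + (- V2) *v (0 \<otimes>\<^sub>v 0)) = 0"
      by (simp add: U(4) bounded_bilinear.zero_left[OF bounded_bilinear_vec_kron])
    have "d' (S *v \<omega>) = A *v (P \<omega> + ((- V1) *v \<omega> + (- V2) *v (\<omega> \<otimes>\<^sub>v \<omega>)))"
      if \<omega>: "\<omega> \<in> U" and d': "((\<lambda>\<omega>. P \<omega> + ((- V1) *v \<omega> + (- V2) *v (\<omega> \<otimes>\<^sub>v \<omega>))) has_derivative d') (at \<omega>)"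
      for \<omega> d'
    proof -
      \<comment> \<open>Adding the quadratic part back turns a derivative of the difference into one
        of \<open>P\<close>, to which the invariance equation applies.\<close>
      have "(P has_derivative (\<lambda>h. d' h + (V1 *v h + V2 *v (\<omega> \<otimes>\<^sub>v h + h \<otimes>\<^sub>v \<omega>)))) (at \<omega>)"
        using has_derivative_add[OF d' has_derivative_quadratic[of V1 V2 \<omega>]] by (simp add: uminus_matrix_vector_mult)
      from jacobian_mult[OF this, of "S *v \<omega>"] eq[OF \<omega>]
      have "d' (S *v \<omega>) + (V1 *v (S *v \<omega>) + V2 *v ((S *v \<omega>) \<otimes>\<^sub>v \<omega> + \<omega> \<otimes>\<^sub>v (S *v \<omega>))) =
          A *v P \<omega> + B *v signal_output L1 L2 \<omega>"
        by (simp add: add.commute)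
      then show ?thesis
        unfolding V1' V2' by (simp add: signal_output_def matrix_vector_right_distrib
            matrix_vector_mult_diff_distrib uminus_matrix_vector_mult algebra_simps)
    qed
    then show "\<forall>\<^sub>F \<omega> in nhds 0. \<forall>d'.
        ((\<lambda>\<omega>. P \<omega> + ((- V1) *v \<omega> + (- V2) *v (\<omega> \<otimes>\<^sub>v \<omega>))) has_derivative d') (at \<omega>) \<longrightarrow>
        norm (d' (S *v \<omega>) - A *v (P \<omega> + ((- V1) *v \<omega> + (- V2) *v (\<omega> \<otimes>\<^sub>v \<omega>)))) \<le>
        0 * norm \<omega> * (norm (P \<omega> + ((- V1) *v \<omega> + (- V2) *v (\<omega> \<otimes>\<^sub>v \<omega>))) + norm (d' (S *v \<omega>)))"
      by (intro eventually_mono[OF eventually_nhds_in_open[OF U(1,2)]]) simp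
  qed
  then show ?thesis
    by eventually_elim (simp add: uminus_matrix_vector_mult algebra_simps)
qed

lemma proj_mat_mult:
  fixes W V1 :: "real^'r^'n"
  assumes "invertible (transpose W ** V1)"
  shows "proj_mat W V1 ** V1 = mat 1"
proof -
  have "matrix_inv (transpose W ** V1) ** (transpose W ** V1) = mat 1"
    using assms unfolding invertible_def matrix_inv_def by (rule someI2_ex) simp
  then show ?thesis
    by (simp add: proj_mat_def matrix_mul_assoc)
qed

text \<open>The equation is quadratic in \<open>p\<close> and implicit in its derivative. In the
  equation for the difference, every term beyond the linear part is bilinear: one factor is the
  difference or its derivative along \<open>S *v \<omega>\<close>, the other is of order
  \<open>norm \<omega>\<close>.\<close>

lemma rom_center_manifold_eq_id:
  fixes A :: "real^'n^'n" and S :: "real^'r^'r"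
  assumes V1: "V1 ** S - A ** V1 = B ** L1"
    and V2: "V2 ** kron_sum S - A ** V2 = B ** L2"
    and W: "invertible (transpose W ** V1)"
    and nonres: "kron_nonresonant (rom_A W V1 A) S"
    and p: "rom_center_manifold (rom_A W V1 A) (rom_B W V1 B) (rom_H W V1 V2 A) (rom_E W V1 V2)
      S L1 L2 p"
  shows "\<forall>\<^sub>F \<omega> in nhds 0. p \<omega> = \<omega>"
proof -
  let ?A = "rom_A W V1 A" and ?B = "rom_B W V1 B" and ?H = "rom_H W V1 V2 A" and ?E = "rom_E W V1 V2"
  obtain U where U: "open U" "0 \<in> U" "real_analytic_on p U" "p 0 = 0"
    and eq: "\<And>\<omega>. \<omega> \<in> U \<Longrightarrow> rom_M ?E (p \<omega>) *v (jacobian p (at \<omega>) *v (S *v \<omega>)) =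
      ?A *v p \<omega> + ?H *v (p \<omega> \<otimes>\<^sub>v p \<omega>) + ?B *v signal_output L1 L2 \<omega>"
    using p unfolding rom_center_manifold_def by blast
  have PV1: "proj_mat W V1 *v (V1 *v y) = y" for y
    by (simp add: matrix_vector_mul_assoc proj_mat_mult[OF W])
  \<comment> \<open>Multiplied by \<open>proj_mat W V1\<close>, the two Sylvester equations say that
    the identity solves the reduced equation in its linear and in its quadratic part.\<close>
  have S: "S *v x = ?A *v x + ?B *v (L1 *v x)" for x
    using arg_cong[OF V1, of "\<lambda>M. proj_mat W V1 *v (M *v x)"]
    by (simp add: matrix_vector_mult_diff_rdistrib matrix_vector_mult_diff_distrib
        matrix_vector_mul_assoc[symmetric] PV1 rom_A_def rom_B_def algebra_simps)
  have E: "?E *v ((S *v x) \<otimes>\<^sub>v x + x \<otimes>\<^sub>v (S *v x)) = ?H *v (x \<otimes>\<^sub>v x) + ?B *v (L2 *v (x \<otimes>\<^sub>v x))" for x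
    using arg_cong[OF V2, of "\<lambda>M. proj_mat W V1 *v (M *v (x \<otimes>\<^sub>v x))"]
    by (simp add: matrix_vector_mult_diff_rdistrib matrix_vector_mult_diff_distrib
        matrix_vector_mul_assoc[symmetric] kron_sum_vec_kron rom_E_def rom_H_def rom_B_def algebra_simps)
  \<comment> \<open>The zero quadratic term gives the map the shape covered by
    \<open>expansion_at_0_quadratic\<close>.\<close>
  let ?d = "\<lambda>\<omega>. p \<omega> + ((- mat 1) *v \<omega> + 0 *v (\<omega> \<otimes>\<^sub>v \<omega>))"
  have d_eq: "?d \<omega> = p \<omega> - \<omega>" for \<omega>
    by (simp add: uminus_matrix_vector_mult)
  have exp_p: "expansion_at_0 p"
    by (rule expansion_at_0_if_real_analytic_on[OF U(3,2)])
  obtain kp where kp: "kp \<ge> 0" "\<forall>\<^sub>F \<omega> in nhds 0. norm (p \<omega>) \<le> kp * norm \<omega>"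
    using linear_bound_at_0[OF expansion_at_0_differentiable[OF exp_p] U(4)] by blast
  obtain kb where kb: "kb \<ge> 0" "\<And>x y. norm ((x :: real^'r) \<otimes>\<^sub>v (y :: real^'r)) \<le> norm x * norm y * kb"
    using bounded_bilinear.nonneg_bounded[OF bounded_bilinear_vec_kron] by blast
  obtain kS where kS: "kS \<ge> 0" "\<And>x. norm (S *v x) \<le> norm x * kS"
    using bounded_linear.nonneg_bounded[OF matrix_vector_mul_bounded_linear] by blast
  obtain kH where kH: "kH \<ge> 0" "\<And>x. norm (?H *v x) \<le> norm x * kH"
    using bounded_linear.nonneg_bounded[OF matrix_vector_mul_bounded_linear] by blast
  obtain kE where kE: "kE \<ge> 0" "\<And>x. norm (?E *v x) \<le> norm x * kE"
    using bounded_linear.nonneg_bounded[OF matrix_vector_mul_bounded_linear] by blast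
  \<comment> \<open>The three summands belong to the \<open>?H\<close> term, the \<open>?E\<close>
    terms with \<open>D\<close> and the \<open>?E\<close> terms with \<open>s\<close> in the
    identity \<open>diff\<close> below.\<close>
  define C where "C = kH * (kb * (kp + 1)) + 2 * (kE * (kb * kp)) + 2 * (kE * (kb * kS))"
  have bound: "norm (D - ?A *v (p \<omega> - \<omega>)) \<le> C * norm \<omega> * (norm (p \<omega> - \<omega>) + norm D)"
    if \<omega>: "\<omega> \<in> U" and p_le: "norm (p \<omega>) \<le> kp * norm \<omega>"
      and D: "jacobian p (at \<omega>) *v (S *v \<omega>) = D + S *v \<omega>" for \<omega> D
  proof -
    define s where "s = S *v \<omega>"
    define d where "d = p \<omega> - \<omega>"
    define N where "N = norm \<omega> * (norm d + norm D)"
    have p: "p \<omega> = d + \<omega>"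
      by (simp add: d_def)
    have eq0: "s + ?E *v (s \<otimes>\<^sub>v \<omega> + \<omega> \<otimes>\<^sub>v s) =
        ?A *v \<omega> + ?H *v (\<omega> \<otimes>\<^sub>v \<omega>) + ?B *v signal_output L1 L2 \<omega>"
      unfolding s_def E by (subst S) (simp add: signal_output_def matrix_vector_right_distrib)
    have eq1: "(D + s) + ?E *v ((D + s) \<otimes>\<^sub>v p \<omega> + p \<omega> \<otimes>\<^sub>v (D + s)) =
        ?A *v p \<omega> + ?H *v (p \<omega> \<otimes>\<^sub>v p \<omega>) + ?B *v signal_output L1 L2 \<omega>"
      using eq[OF \<omega>] unfolding D rom_M_mult s_def .
    \<comment> \<open>Products are subtracted by telescoping, as in \<open>p \<omega>
      \<otimes>\<^sub>v p \<omega> - \<omega> \<otimes>\<^sub>v \<omega> = d \<otimes>\<^sub>v p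
      \<omega> + \<omega> \<otimes>\<^sub>v d\<close>.\<close>
    have diff: "D - ?A *v d = ?H *v (d \<otimes>\<^sub>v p \<omega> + \<omega> \<otimes>\<^sub>v d) -
        ?E *v (D \<otimes>\<^sub>v p \<omega> + p \<omega> \<otimes>\<^sub>v D) - ?E *v (s \<otimes>\<^sub>v d + d \<otimes>\<^sub>v s)"
      using arg_cong2[OF eq1 eq0, of "(-)"] unfolding p
      by (simp add: vec_kron_simps matrix_vector_right_distrib algebra_simps)
    have N: "norm d * norm \<omega> \<le> N" "norm D * norm \<omega> \<le> N"
      by (simp_all add: N_def algebra_simps)
    have kron_le: "norm (x \<otimes>\<^sub>v y) \<le> kb * (k * N)"
      if "norm x \<le> a" "norm y \<le> b" "a * b \<le> k * N" "a \<ge> 0" for x y :: "real^'r" and a b k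
    proof -
      have "norm x * norm y \<le> k * N"
        using mult_mono[OF that(1,2,4) norm_ge_zero] that(3) by linarith
      from order_trans[OF kb(2) mult_right_mono[OF this kb(1)]] show ?thesis
        by (simp add: mult_ac)
    qed
    have H_le: "norm (?H *v x) \<le> kH * b" if "norm x \<le> b" for x b
      using order_trans[OF kH(2) mult_right_mono[OF that kH(1)]] by (simp add: mult.commute)
    have E_le: "norm (?E *v x) \<le> kE * b" if "norm x \<le> b" for x b
      using order_trans[OF kE(2) mult_right_mono[OF that kE(1)]] by (simp add: mult.commute)
    have s_le: "norm s \<le> kS * norm \<omega>"
      using kS(2)[of \<omega>] by (simp add: s_def mult.commute)
    have *: "norm d * (k * norm \<omega>) \<le> k * N" "k * norm \<omega> * norm d \<le> k * N"
      "norm D * (k * norm \<omega>) \<le> k * N" "k * norm \<omega> * norm D \<le> k * N" if "k \<ge> 0" for k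
      using mult_left_mono[OF N(1) that] mult_left_mono[OF N(2) that] by (simp_all add: mult_ac)
    have "norm (d \<otimes>\<^sub>v p \<omega>) \<le> kb * (kp * N)"
      by (rule kron_le[OF order_refl p_le *(1)[OF kp(1)]]) simp
    moreover have "norm (\<omega> \<otimes>\<^sub>v d) \<le> kb * (1 * N)"
      by (rule kron_le[OF order_refl order_refl]) (use *(2)[of 1] in simp_all)
    ultimately have "norm (d \<otimes>\<^sub>v p \<omega> + \<omega> \<otimes>\<^sub>v d) \<le> kb * (kp + 1) * N"
      using norm_triangle_ineq[of "d \<otimes>\<^sub>v p \<omega>" "\<omega> \<otimes>\<^sub>v d"] by (simp add: algebra_simps)
    then have 1: "norm (?H *v (d \<otimes>\<^sub>v p \<omega> + \<omega> \<otimes>\<^sub>v d)) \<le> kH * (kb * (kp + 1) * N)"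
      by (rule H_le)
    have "norm (D \<otimes>\<^sub>v p \<omega>) \<le> kb * (kp * N)"
      by (rule kron_le[OF order_refl p_le *(3)[OF kp(1)]]) simp
    moreover have "norm (p \<omega> \<otimes>\<^sub>v D) \<le> kb * (kp * N)"
      by (rule kron_le[OF p_le order_refl *(4)[OF kp(1)]]) (simp add: kp(1))
    ultimately have "norm (D \<otimes>\<^sub>v p \<omega> + p \<omega> \<otimes>\<^sub>v D) \<le> 2 * (kb * kp) * N"
      using norm_triangle_ineq[of "D \<otimes>\<^sub>v p \<omega>" "p \<omega> \<otimes>\<^sub>v D"] by (simp add: algebra_simps)
    then have 2: "norm (?E *v (D \<otimes>\<^sub>v p \<omega> + p \<omega> \<otimes>\<^sub>v D)) \<le> kE * (2 * (kb * kp) * N)"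
      by (rule E_le)
    have "norm (s \<otimes>\<^sub>v d) \<le> kb * (kS * N)"
      by (rule kron_le[OF s_le order_refl *(2)[OF kS(1)]]) (simp add: kS(1))
    moreover have "norm (d \<otimes>\<^sub>v s) \<le> kb * (kS * N)"
      by (rule kron_le[OF order_refl s_le *(1)[OF kS(1)]]) simp
    ultimately have "norm (s \<otimes>\<^sub>v d + d \<otimes>\<^sub>v s) \<le> 2 * (kb * kS) * N"
      using norm_triangle_ineq[of "s \<otimes>\<^sub>v d" "d \<otimes>\<^sub>v s"] by (simp add: algebra_simps)
    then have 3: "norm (?E *v (s \<otimes>\<^sub>v d + d \<otimes>\<^sub>v s)) \<le> kE * (2 * (kb * kS) * N)"
      by (rule E_le)
    have "norm (D - ?A *v d) \<le> kH * (kb * (kp + 1) * N) + kE * (2 * (kb * kp) * N) + kE * (2 * (kb * kS) * N)"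
      unfolding diff
      by (rule order_trans[OF norm_triangle_ineq4] add_mono 1 2 3)+
    also have "\<dots> = C * N"
      by (simp add: C_def algebra_simps)
    finally show ?thesis
      by (simp add: N_def d_def mult.assoc)
  qed
  have "\<forall>\<^sub>F \<omega> in nhds 0. ?d \<omega> = 0"
  proof (rule nonresonant_unique_zero[OF nonres, where C = C])
    show "expansion_at_0 ?d"
      by (intro expansion_at_0_add[OF exp_p] expansion_at_0_quadratic)
    show "?d 0 = 0"
      unfolding d_eq by (simp add: U(4))
    show "\<forall>\<^sub>F \<omega> in nhds 0. \<forall>d'. (?d has_derivative d') (at \<omega>) \<longrightarrow>
        norm (d' (S *v \<omega>) - ?A *v ?d \<omega>) \<le> C * norm \<omega> * (norm (?d \<omega>) + norm (d' (S *v \<omega>)))"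
      using kp(2) eventually_nhds_in_open[OF U(1,2)] unfolding d_eq
    proof eventually_elim
      case (elim \<omega>)
      show ?case
      proof (intro allI impI)
        fix d' assume "((\<lambda>\<omega>. p \<omega> - \<omega>) has_derivative d') (at \<omega>)"
        from has_derivative_add[OF this has_derivative_ident]
        have "(p has_derivative (\<lambda>h. d' h + h)) (at \<omega>)" by simp
        from jacobian_mult[OF this] elim
        show "norm (d' (S *v \<omega>) - ?A *v (p \<omega> - \<omega>)) \<le>
            C * norm \<omega> * (norm (p \<omega> - \<omega>) + norm (d' (S *v \<omega>)))"
          by (intro bound)
      qed
    qed
  qed
  then show ?thesis
    unfolding d_eq by simp
qed

theorem theorem4p5:
  fixes A :: "real^'n^'n" and B :: "real^'m^'n" and C :: "real^'n^'p"
    and S :: "real^'r^'r" and L1 :: "real^'r^'m" and L2 :: "real^('r \<times> 'r)^'m"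
    and V1 W :: "real^'r^'n" and V2 :: "real^('r \<times> 'r)^'n"
    and \<Pi>\<^sub>f :: "real^'r \<Rightarrow> real^'n" and \<pi>\<^sub>r :: "real^'r \<Rightarrow> real^'r"
  assumes "rank S = CARD('r)"
    and "kron_nonresonant A S"
    and "V1 ** S - A ** V1 = B ** L1"
    and "V2 ** kron_sum S - A ** V2 = B ** L2"
    and "invertible (transpose W ** V1)"
    and "kron_nonresonant (rom_A W V1 A) S"
    and "fom_center_manifold A B S L1 L2 \<Pi>\<^sub>f"
    and "rom_center_manifold (rom_A W V1 A) (rom_B W V1 B) (rom_H W V1 V2 A) (rom_E W V1 V2)
           S L1 L2 \<pi>\<^sub>r"
  shows "(\<forall>\<^sub>F \<omega> in nhds 0. \<Pi>\<^sub>f \<omega> = V1 *v \<pi>\<^sub>r \<omega> + V2 *v (\<pi>\<^sub>r \<omega> \<otimes>\<^sub>v \<pi>\<^sub>r \<omega>)) \<and>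
         (\<forall>\<^sub>F \<omega> in nhds 0. fom_moment C \<Pi>\<^sub>f \<omega> = rom_moment (rom_C V1 C) (rom_K V2 C) \<pi>\<^sub>r \<omega>)"
proof -
  have "\<forall>\<^sub>F \<omega> in nhds 0. \<Pi>\<^sub>f \<omega> = V1 *v \<pi>\<^sub>r \<omega> + V2 *v (\<pi>\<^sub>r \<omega> \<otimes>\<^sub>v \<pi>\<^sub>r \<omega>)"
    using fom_center_manifold_eq[OF assms(2-4,7)] rom_center_manifold_eq_id[OF assms(3-6,8)]
    by eventually_elim simp
  moreover from this
  have "\<forall>\<^sub>F \<omega> in nhds 0. fom_moment C \<Pi>\<^sub>f \<omega> = rom_moment (rom_C V1 C) (rom_K V2 C) \<pi>\<^sub>r \<omega>"
    by eventually_elim (simp add: fom_moment_def rom_moment_def rom_C_def rom_K_def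
        matrix_vector_right_distrib matrix_vector_mul_assoc)
  ultimately show ?thesis by blast
qed

end
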